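(* Let $s>3/2$, let $u_0\in H^s(\mathbb{R})$ be real-valued, and let $T^*\in(0,\infty]$ be the maximal existence time of the unique solution $u\in C([0,T^* ),H^s(\mathbb{R}))\cap C^1([0,T^* ),H^{s-1}(\mathbb{R}))$ of the Camassa--Holm equation on $\mathbb{R}$ $$u_t+uu_x=-\partial_x p*\left(u^2+\frac12u_x^2\right),\qquad u(0,x)=u_0(x),$$ where $p(x)=\frac12e^{-|x|}$. If there exists $x_0\in\mathbb{R}$ such that $$u_0'(x_0)<-|u_0(x_0)|,$$ then $T^*<\infty$.
   Context: All functions are real-valued, $*$ denotes convolution in the space variable $x\in\mathbb{R}$, and $p(x)=\frac12e^{-|x|}$ is the fundamental solution of $1-\partial_x^2$. For $s>3/2$, $H^s(\mathbb{R})$ embeds in $C^1(\mathbb{R})$, so $u_0(x_0)$ and $u_0'(x_0)$ are meaningful pointwise. It is known that the Cauchy problem is locally well-posed in $H^s(\mathbb{R})$, $s>3/2$: for every $u_0\in H^s(\mathbb{R})$ there is a maximal time $0<T^*\le\infty$ and a unique solution $u\in C([0,T^* ),H^s)\cap C^1([0,T^* ),H^{s-1})$, depending continuously on $u_0$; $T^*$ is the supremum of the times up to which a solution in this class exists. *)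

theory Defs
  imports "HOL-Analysis.Analysis"
begin

text \<open>
  The Fourier transform on \<open>L\<^sup>2(\<real>)\<close> (Plancherel): the \<open>L\<^sup>2\<close>-limit of the transforms of the
  truncations of \<open>f\<close> to \<open>[-n, n]\<close>. The limit is expressed with the nonnegative integral, which,
  unlike the Bochner integral, does not return 0 on functions that fail to be integrable.
\<close>

definition has_L2_fourier :: "(real \<Rightarrow> real) \<Rightarrow> (real \<Rightarrow> complex) \<Rightarrow> bool" where
  "has_L2_fourier f g \<longleftrightarrow>
     f \<in> borel_measurable lborel \<and> integrable lborel (\<lambda>x. (f x)\<^sup>2) \<and>
     g \<in> borel_measurable lborel \<and> integrable lborel (\<lambda>\<xi>. (cmod (g \<xi>))\<^sup>2) \<and>
     (\<lambda>n::nat. \<integral>\<^sup>+\<xi>. ennreal ((cmod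
        ((LINT x:{- real n..real n}|lborel. complex_of_real (f x) * cis (- (x * \<xi>))) - g \<xi>))\<^sup>2) \<partial>lborel)
       \<longlonglongrightarrow> 0"

text \<open>The transform is determined up to null sets; only integrals of it are used below.\<close>

definition L2_fourier :: "(real \<Rightarrow> real) \<Rightarrow> real \<Rightarrow> complex" where
  "L2_fourier f = (SOME g. has_L2_fourier f g)"

text \<open>
  \<open>H\<^sup>s(\<real>)\<close>, real-valued, for \<open>s > 1/2\<close>. Each class of almost everywhere equal functions
  then has exactly one continuous member, and \<open>sobolev_space s\<close> consists of these
  representatives, so that point values are meaningful (and, if \<open>s > 3/2\<close>, derivatives too).
\<close>

definition sobolev_space :: "real \<Rightarrow> (real \<Rightarrow> real) set" where
  "sobolev_space s = {f. continuous_on UNIV f \<and> (\<exists>g. has_L2_fourier f g) \<and>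
     integrable lborel (\<lambda>\<xi>. (1 + \<xi>\<^sup>2) powr s * (cmod (L2_fourier f \<xi>))\<^sup>2)}"

definition sobolev_norm :: "real \<Rightarrow> (real \<Rightarrow> real) \<Rightarrow> real" where
  "sobolev_norm s f = sqrt (LINT \<xi>|lborel. (1 + \<xi>\<^sup>2) powr s * (cmod (L2_fourier f \<xi>))\<^sup>2)"

definition sobolev_continuous_on :: "real \<Rightarrow> real set \<Rightarrow> (real \<Rightarrow> real \<Rightarrow> real) \<Rightarrow> bool" where
  "sobolev_continuous_on s I u \<longleftrightarrow>
     (\<forall>t\<in>I. u t \<in> sobolev_space s) \<and>
     (\<forall>t\<in>I. ((\<lambda>\<tau>. sobolev_norm s (\<lambda>x. u \<tau> x - u t x)) \<longlongrightarrow> 0) (at t within I))"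

definition sobolev_has_derivative_on ::
    "real \<Rightarrow> real set \<Rightarrow> (real \<Rightarrow> real \<Rightarrow> real) \<Rightarrow> (real \<Rightarrow> real \<Rightarrow> real) \<Rightarrow> bool" where
  "sobolev_has_derivative_on s I u u_t \<longleftrightarrow>
     (\<forall>t\<in>I. u t \<in> sobolev_space s \<and> u_t t \<in> sobolev_space s) \<and>
     (\<forall>t\<in>I. ((\<lambda>\<tau>. sobolev_norm s (\<lambda>x. (u \<tau> x - u t x) / (\<tau> - t) - u_t t x)) \<longlongrightarrow> 0)
               (at t within I))"

definition convolve :: "(real \<Rightarrow> real) \<Rightarrow> (real \<Rightarrow> real) \<Rightarrow> real \<Rightarrow> real" where
  "convolve f g x = (LINT y|lborel. f (x - y) * g y)"

definition CH_kernel :: "real \<Rightarrow> real" where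
  "CH_kernel x = exp (- \<bar>x\<bar>) / 2"

text \<open>
  \<open>u t x\<close> solves the Cauchy problem on \<open>[0, T)\<close> in the class
  \<open>C([0,T), H\<^sup>s) \<inter> C\<^sup>1([0,T), H\<^sup>s\<^sup>-\<^sup>1)\<close>, \<open>s > 3/2\<close>. The equation is an identity in \<open>H\<^sup>s\<^sup>-\<^sup>1\<close>;
  as both sides are continuous in \<open>x\<close>, it holds at every point.
\<close>

definition CH_solution :: "real \<Rightarrow> (real \<Rightarrow> real) \<Rightarrow> ereal \<Rightarrow> (real \<Rightarrow> real \<Rightarrow> real) \<Rightarrow> bool" where
  "CH_solution s u0 T u \<longleftrightarrow>
     (let I = {t. 0 \<le> t \<and> ereal t < T} in
      sobolev_continuous_on s I u \<and>
      u 0 = u0 \<and>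
      (\<exists>u_t. sobolev_has_derivative_on (s - 1) I u u_t \<and>
             sobolev_continuous_on (s - 1) I u_t \<and>
             (\<forall>t\<in>I. \<forall>x. u_t t x + u t x * deriv (u t) x =
                - deriv (convolve CH_kernel (\<lambda>y. (u t y)\<^sup>2 + (deriv (u t) y)\<^sup>2 / 2)) x)))"

definition CH_existence_time :: "real \<Rightarrow> (real \<Rightarrow> real) \<Rightarrow> ereal" where
  "CH_existence_time s u0 = Sup {T. 0 < T \<and> (\<exists>u. CH_solution s u0 T u)}"

end

theory Submission
  imports Defs "HOL-Probability.Characteristic_Functions"
begin

text \<open>
  Along a characteristic \<open>q' = u t q\<close>, the functions \<open>a = u - u\<^sub>x\<close> and \<open>b = - u - u\<^sub>x\<close> satisfy
  \<open>a' = L - u\<^sup>2 + u\<^sub>x\<^sup>2/2\<close> and \<open>b' = R - u\<^sup>2 + u\<^sub>x\<^sup>2/2\<close>, where \<open>L\<close> and \<open>R\<close> are the parts of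
  \<open>2 p * (u\<^sup>2 + u\<^sub>x\<^sup>2/2)\<close> coming from the left and from the right. Both \<open>L\<close> and \<open>R\<close> are at least
  \<open>u\<^sup>2/2\<close>, so \<open>a'\<close> and \<open>b'\<close> are at least \<open>a b/2\<close>, and a solution that starts with \<open>a, b > 0\<close>
  cannot last beyond the time \<open>1/a + 1/b\<close>. Well-posedness is not needed: for \<open>s > 3/2\<close> Fourier
  inversion bounds the sup norms of \<open>f\<close> and \<open>f'\<close> by the \<open>H\<^sup>s\<close> norm, which makes a solution
  classical enough for the argument.
\<close>

section \<open>The Fourier transform on \<open>L\<^sup>2\<close>\<close>

text \<open>The hypothesis says exactly that \<open>a\<close> and \<open>b\<close> are positive at
  the start. Two facts single them out. Along a characteristic \<open>u' = (L - R)/2\<close> and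
  \<open>u\<^sub>x' = u\<^sup>2 - u\<^sub>x\<^sup>2/2 - (L + R)/2\<close>, so each combination keeps
  one half of the nonlocal term, with a plus sign, and a lower bound for that half is enough. And
  \<open>a b = u\<^sub>x\<^sup>2 - u\<^sup>2\<close>, which is twice what the bound by
  \<open>u\<^sup>2/2\<close> leaves over. The constant matters: with \<open>L \<ge> 0\<close> alone
  the right side could be negative while \<open>a\<close> and \<open>b\<close> are positive. The
  obstacle is regularity. A solution is only C^1 in x, so no second space derivative is available
  for the evolution of \<open>u\<^sub>x\<close>. The Sobolev norm sees a function only through a
  transform defined by an L2 limit, so even sup bounds must be recovered from an inversion theorem.
  The threshold 3/2 is spent twice: on the sup norm of \<open>u\<^sub>x\<close>, and on that of
  \<open>u\<^sub>t\<close>, which is controlled only in \<open>H^(s-1)\<close>, where s - 1 >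
  1/2.\<close>

lemma integrable_powr_weight:
  fixes r :: real
  assumes "r > 1 / 2"
  shows "integrable lborel (\<lambda>x::real. (1 + x\<^sup>2) powr (- r))"
proof -
  define h where "h = (\<lambda>x::real. indicator {1..} x * x powr (- 2 * r))"
  have [measurable]: "h \<in> borel_measurable borel"
    unfolding h_def by measurable
  have "(\<lambda>x. x powr (- 2 * r)) absolutely_integrable_on {1..}"
    using has_integral_powr_to_inf[of "- 2 * r" 1] assms
    by (intro nonnegative_absolutely_integrable_1) (auto simp: integrable_on_def)
  then have "integrable lebesgue h"
    by (simp add: set_integrable_def h_def mult.commute)
  then have 1: "integrable lborel h"
    by (simp add: integrable_completion)
  have 2: "integrable lborel (\<lambda>x. h (- x))"
    using lborel_integrable_real_affine[OF 1, of "-1" 0] by simp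
  have 3: "integrable lborel (indicator {-1..1::real} :: real \<Rightarrow> real)"
    by (rule integrable_real_indicator) auto
  \<comment> \<open>The weight is at most 1 on [-1, 1] and at most |x|^(-2r) elsewhere, with 2r > 1;
    \<open>h\<close> and its reflection are the two tails.\<close>
  have "(1 + x\<^sup>2) powr (- r) \<le> h x + h (- x) + indicator {-1..1} x" for x :: real
  proof (cases "\<bar>x\<bar> \<le> 1")
    case True
    have "(1 + x\<^sup>2) powr (- r) \<le> 1"
      using assms by (simp add: powr_minus inverse_le_1_iff ge_one_powr_ge_zero)
    then show ?thesis
      using True by (auto simp: h_def indicator_def abs_le_iff)
  next
    case False
    have "(1 + x\<^sup>2) powr (- r) \<le> (x\<^sup>2) powr (- r)"
      using False assms by (intro powr_mono2') auto
    also have "(x\<^sup>2) powr (- r) = \<bar>x\<bar> powr (- 2 * r)"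
      using False powr_powr[of "\<bar>x\<bar>" 2 "- r"] by simp
    also have "\<dots> \<le> h x + h (- x) + indicator {-1..1} x"
      using False by (auto simp: h_def indicator_def abs_if)
    finally show ?thesis .
  qed
  then have le: "norm ((1 + x\<^sup>2) powr (- r)) \<le> norm (h x + h (- x) + indicator {-1..1} x)" for x :: real
    by (simp add: order_trans[OF _ abs_ge_self])
  show ?thesis
  proof (rule Bochner_Integration.integrable_bound)
    show "integrable lborel (\<lambda>x. h x + h (- x) + indicator {-1..1} x)"
      using 1 2 3 by (intro Bochner_Integration.integrable_add)
    show "AE x in lborel. norm ((1 + x\<^sup>2) powr (- r)) \<le> norm (h x + h (- x) + indicator {-1..1} x)"
      using le by simp
  qed measurable
qed

lemma Cauchy_Schwarz_integral:
  fixes f g :: "'a \<Rightarrow> real"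
  assumes [measurable]: "f \<in> borel_measurable M" "g \<in> borel_measurable M"
    and f: "integrable M (\<lambda>x. (f x)\<^sup>2)" and g: "integrable M (\<lambda>x. (g x)\<^sup>2)"
  shows "integrable M (\<lambda>x. f x * g x)"
    and "(LINT x|M. \<bar>f x * g x\<bar>) \<le> sqrt (LINT x|M. (f x)\<^sup>2) * sqrt (LINT x|M. (g x)\<^sup>2)"
proof -
  have le: "\<bar>f x * g x\<bar> \<le> (f x)\<^sup>2 + (g x)\<^sup>2" for x
  proof -
    have "0 \<le> \<bar>f x\<bar> * \<bar>g x\<bar>"
      by simp
    then show ?thesis
      using sum_squares_bound[of "\<bar>f x\<bar>" "\<bar>g x\<bar>"] unfolding abs_mult power2_abs by linarith
  qed
  show *: "integrable M (\<lambda>x. f x * g x)"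
    by (intro Bochner_Integration.integrable_bound[OF Bochner_Integration.integrable_add[OF f g]])
       (measurable, rule AE_I2, simp add: order_trans[OF le])
  have "ennreal ((LINT x|M. \<bar>f x * g x\<bar>)\<^sup>2) = (\<integral>\<^sup>+x. ennreal \<bar>f x\<bar> * ennreal \<bar>g x\<bar> \<partial>M)\<^sup>2"
    using integrable_abs[OF *] by (simp add: nn_integral_eq_integral abs_mult ennreal_power integral_nonneg flip: ennreal_mult)
  also have "\<dots> \<le> (\<integral>\<^sup>+x. (ennreal \<bar>f x\<bar>)\<^sup>2 \<partial>M) * (\<integral>\<^sup>+x. (ennreal \<bar>g x\<bar>)\<^sup>2 \<partial>M)"
    by (rule Cauchy_Schwarz_nn_integral) auto
  also have "\<dots> = ennreal ((LINT x|M. (f x)\<^sup>2) * (LINT x|M. (g x)\<^sup>2))"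
    using f g by (simp add: ennreal_power nn_integral_eq_integral ennreal_mult integral_nonneg)
  finally have "(LINT x|M. \<bar>f x * g x\<bar>)\<^sup>2 \<le> (LINT x|M. (f x)\<^sup>2) * (LINT x|M. (g x)\<^sup>2)"
    by (subst (asm) ennreal_le_iff) (auto intro!: mult_nonneg_nonneg integral_nonneg)
  then show "(LINT x|M. \<bar>f x * g x\<bar>) \<le> sqrt (LINT x|M. (f x)\<^sup>2) * sqrt (LINT x|M. (g x)\<^sup>2)"
    by (simp add: real_le_rsqrt flip: real_sqrt_mult)
qed

text \<open>A square integrable function is integrable on bounded intervals, so these approximants
  from \<open>has_L2_fourier\<close> are genuine L1 transforms, bounded and open to Fubini.
  Linearity and the pairing with a weight are proved for them and passed to the limit.\<close>

definition trunc_fourier :: "(real \<Rightarrow> real) \<Rightarrow> nat \<Rightarrow> real \<Rightarrow> complex" where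
  "trunc_fourier f n \<xi> = (LINT x:{- real n..real n}|lborel. complex_of_real (f x) * cis (- (x * \<xi>)))"

lemma borel_measurable_cis [measurable]: "cis \<in> borel_measurable borel"
  by (intro borel_measurable_continuous_onI continuous_intros)

lemma borel_measurable_trunc_fourier [measurable]:
  assumes [measurable]: "f \<in> borel_measurable borel"
  shows "trunc_fourier f n \<in> borel_measurable borel"
  unfolding trunc_fourier_def set_lebesgue_integral_def by measurable

lemma integrable_truncation:
  fixes f :: "real \<Rightarrow> real"
  assumes [measurable]: "f \<in> borel_measurable borel" and "integrable lborel (\<lambda>x. (f x)\<^sup>2)"
  shows "integrable lborel (\<lambda>x. indicator {- real n..real n} x * f x)"
proof (rule Cauchy_Schwarz_integral(1)[OF _ _ _ assms(2)])
  have "(\<lambda>x. (indicator {- real n..real n} x)\<^sup>2) = (indicator {- real n..real n} :: real \<Rightarrow> real)"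
    by (auto simp: indicator_def)
  then show "integrable lborel (\<lambda>x. (indicator {- real n..real n} x :: real)\<^sup>2)"
    by simp
qed auto

lemma integrable_truncation_cis:
  fixes f :: "real \<Rightarrow> real"
  assumes [measurable]: "f \<in> borel_measurable borel" and "integrable lborel (\<lambda>x. (f x)\<^sup>2)"
  shows "integrable lborel (\<lambda>x. indicator {- real n..real n} x *\<^sub>R (complex_of_real (f x) * cis (- (x * \<xi>))))"
  by (rule Bochner_Integration.integrable_bound[OF integrable_truncation[OF assms, of n]])
     (auto simp: norm_mult)

lemma has_L2_fourier_trunc:
  "has_L2_fourier f g \<longleftrightarrow>
     f \<in> borel_measurable borel \<and> integrable lborel (\<lambda>x. (f x)\<^sup>2) \<and>
     g \<in> borel_measurable borel \<and> integrable lborel (\<lambda>\<xi>. (cmod (g \<xi>))\<^sup>2) \<and>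
     (\<lambda>n. \<integral>\<^sup>+\<xi>. ennreal ((cmod (trunc_fourier f n \<xi> - g \<xi>))\<^sup>2) \<partial>lborel) \<longlonglongrightarrow> 0"
  by (simp add: has_L2_fourier_def trunc_fourier_def)

lemma norm_sum_squared_le:
  fixes a b :: "'a::real_normed_vector"
  shows "(norm (a + b))\<^sup>2 \<le> 2 * (norm a)\<^sup>2 + 2 * (norm b)\<^sup>2"
proof -
  have "(norm (a + b))\<^sup>2 \<le> (norm a + norm b)\<^sup>2"
    by (intro power_mono norm_triangle_ineq) auto
  also have "\<dots> \<le> 2 * (norm a)\<^sup>2 + 2 * (norm b)\<^sup>2"
    using sum_squares_bound[of "norm a" "norm b"] by (simp add: power2_sum)
  finally show ?thesis .
qed

text \<open>Stands in for the triangle inequality in L2. The factor 2 is harmless, since the terms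
  on the right tend to 0 wherever this is applied.\<close>

lemma nn_integral_norm_sum_squared_le:
  fixes F G :: "'a \<Rightarrow> complex"
  assumes [measurable]: "F \<in> borel_measurable M" "G \<in> borel_measurable M"
  shows "(\<integral>\<^sup>+x. ennreal ((cmod (F x + G x))\<^sup>2) \<partial>M)
    \<le> 2 * (\<integral>\<^sup>+x. ennreal ((cmod (F x))\<^sup>2) \<partial>M) + 2 * (\<integral>\<^sup>+x. ennreal ((cmod (G x))\<^sup>2) \<partial>M)"
proof -
  have "(\<integral>\<^sup>+x. ennreal ((cmod (F x + G x))\<^sup>2) \<partial>M)
      \<le> (\<integral>\<^sup>+x. 2 * ennreal ((cmod (F x))\<^sup>2) + 2 * ennreal ((cmod (G x))\<^sup>2) \<partial>M)"
  proof (rule nn_integral_mono)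
    fix x
    have "ennreal ((cmod (F x + G x))\<^sup>2) \<le> ennreal (2 * (cmod (F x))\<^sup>2 + 2 * (cmod (G x))\<^sup>2)"
      by (intro ennreal_leI norm_sum_squared_le)
    also have "\<dots> = 2 * ennreal ((cmod (F x))\<^sup>2) + 2 * ennreal ((cmod (G x))\<^sup>2)"
      by (simp add: ennreal_mult)
    finally show "ennreal ((cmod (F x + G x))\<^sup>2) \<le> 2 * ennreal ((cmod (F x))\<^sup>2) + 2 * ennreal ((cmod (G x))\<^sup>2)" .
  qed
  then show ?thesis
    by (simp add: nn_integral_add nn_integral_cmult)
qed

lemma trunc_fourier_lincomb:
  assumes "f1 \<in> borel_measurable borel" "integrable lborel (\<lambda>x. (f1 x)\<^sup>2)"
    and "f2 \<in> borel_measurable borel" "integrable lborel (\<lambda>x. (f2 x)\<^sup>2)"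
  shows "trunc_fourier (\<lambda>x. a * f1 x + b * f2 x) n \<xi> =
    complex_of_real a * trunc_fourier f1 n \<xi> + complex_of_real b * trunc_fourier f2 n \<xi>"
proof -
  note i1 = integrable_truncation_cis[OF assms(1,2), of n \<xi>]
  note i2 = integrable_truncation_cis[OF assms(3,4), of n \<xi>]
  have "trunc_fourier (\<lambda>x. a * f1 x + b * f2 x) n \<xi> = (LINT x|lborel.
      complex_of_real a * (indicator {- real n..real n} x *\<^sub>R (complex_of_real (f1 x) * cis (- (x * \<xi>)))) +
      complex_of_real b * (indicator {- real n..real n} x *\<^sub>R (complex_of_real (f2 x) * cis (- (x * \<xi>)))))"
    unfolding trunc_fourier_def set_lebesgue_integral_def
    by (intro Bochner_Integration.integral_cong) (auto simp: algebra_simps scaleR_conv_of_real)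
  also have "\<dots> = complex_of_real a * trunc_fourier f1 n \<xi> + complex_of_real b * trunc_fourier f2 n \<xi>"
    unfolding trunc_fourier_def set_lebesgue_integral_def
    by (simp only: Bochner_Integration.integral_add[OF integrable_mult_right[OF i1] integrable_mult_right[OF i2]]
        integral_mult_right_zero)
  finally show ?thesis .
qed

lemma has_L2_fourier_lincomb:
  assumes "has_L2_fourier f1 g1" "has_L2_fourier f2 g2"
  shows "has_L2_fourier (\<lambda>x. a * f1 x + b * f2 x)
    (\<lambda>\<xi>. complex_of_real a * g1 \<xi> + complex_of_real b * g2 \<xi>)"
proof -
  have [measurable]: "f1 \<in> borel_measurable borel" "f2 \<in> borel_measurable borel"
      "g1 \<in> borel_measurable borel" "g2 \<in> borel_measurable borel"
    and f: "integrable lborel (\<lambda>x. (f1 x)\<^sup>2)" "integrable lborel (\<lambda>x. (f2 x)\<^sup>2)"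
    and g: "integrable lborel (\<lambda>x. (cmod (g1 x))\<^sup>2)" "integrable lborel (\<lambda>x. (cmod (g2 x))\<^sup>2)"
    and l1: "(\<lambda>n. \<integral>\<^sup>+\<xi>. ennreal ((cmod (trunc_fourier f1 n \<xi> - g1 \<xi>))\<^sup>2) \<partial>lborel) \<longlonglongrightarrow> 0"
    and l2: "(\<lambda>n. \<integral>\<^sup>+\<xi>. ennreal ((cmod (trunc_fourier f2 n \<xi> - g2 \<xi>))\<^sup>2) \<partial>lborel) \<longlonglongrightarrow> 0"
    using assms unfolding has_L2_fourier_trunc by auto
  let ?f = "\<lambda>x. a * f1 x + b * f2 x"
  let ?g = "\<lambda>\<xi>. complex_of_real a * g1 \<xi> + complex_of_real b * g2 \<xi>"
  let ?D1 = "\<lambda>n. \<integral>\<^sup>+\<xi>. ennreal ((cmod (trunc_fourier f1 n \<xi> - g1 \<xi>))\<^sup>2) \<partial>lborel"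
  let ?D2 = "\<lambda>n. \<integral>\<^sup>+\<xi>. ennreal ((cmod (trunc_fourier f2 n \<xi> - g2 \<xi>))\<^sup>2) \<partial>lborel"
  have f': "integrable lborel (\<lambda>x. (?f x)\<^sup>2)"
  proof (rule Bochner_Integration.integrable_bound)
    show "integrable lborel (\<lambda>x. 2 * (a\<^sup>2 * (f1 x)\<^sup>2) + 2 * (b\<^sup>2 * (f2 x)\<^sup>2))"
      using f by auto
    show "AE x in lborel. norm ((?f x)\<^sup>2) \<le> norm (2 * (a\<^sup>2 * (f1 x)\<^sup>2) + 2 * (b\<^sup>2 * (f2 x)\<^sup>2))"
      using norm_sum_squared_le[of "a * f1 _" "b * f2 _"] by (auto simp: power_mult_distrib)
  qed auto
  have g': "integrable lborel (\<lambda>x. (cmod (?g x))\<^sup>2)"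
  proof (rule Bochner_Integration.integrable_bound)
    show "integrable lborel (\<lambda>x. 2 * (a\<^sup>2 * (cmod (g1 x))\<^sup>2) + 2 * (b\<^sup>2 * (cmod (g2 x))\<^sup>2))"
      using g by auto
    show "AE x in lborel. norm ((cmod (?g x))\<^sup>2)
        \<le> norm (2 * (a\<^sup>2 * (cmod (g1 x))\<^sup>2) + 2 * (b\<^sup>2 * (cmod (g2 x))\<^sup>2))"
      using norm_sum_squared_le[of "complex_of_real a * g1 _" "complex_of_real b * g2 _"]
      by (auto simp: norm_mult power_mult_distrib)
  qed auto
  have le: "(\<integral>\<^sup>+\<xi>. ennreal ((cmod (trunc_fourier ?f n \<xi> - ?g \<xi>))\<^sup>2) \<partial>lborel)
      \<le> 2 * (ennreal (a\<^sup>2) * ?D1 n) + 2 * (ennreal (b\<^sup>2) * ?D2 n)" for n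
  proof -
    have "(\<integral>\<^sup>+\<xi>. ennreal ((cmod (trunc_fourier ?f n \<xi> - ?g \<xi>))\<^sup>2) \<partial>lborel) =
      (\<integral>\<^sup>+\<xi>. ennreal ((cmod (complex_of_real a * (trunc_fourier f1 n \<xi> - g1 \<xi>) +
          complex_of_real b * (trunc_fourier f2 n \<xi> - g2 \<xi>)))\<^sup>2) \<partial>lborel)"
      using f by (subst trunc_fourier_lincomb) (auto simp: algebra_simps)
    also have "\<dots> \<le> 2 * (\<integral>\<^sup>+\<xi>. ennreal ((cmod (complex_of_real a * (trunc_fourier f1 n \<xi> - g1 \<xi>)))\<^sup>2) \<partial>lborel) +
        2 * (\<integral>\<^sup>+\<xi>. ennreal ((cmod (complex_of_real b * (trunc_fourier f2 n \<xi> - g2 \<xi>)))\<^sup>2) \<partial>lborel)"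
      by (rule nn_integral_norm_sum_squared_le) measurable
    also have "\<dots> = 2 * (ennreal (a\<^sup>2) * ?D1 n) + 2 * (ennreal (b\<^sup>2) * ?D2 n)"
      by (simp add: norm_mult power_mult_distrib ennreal_mult nn_integral_cmult)
    finally show ?thesis .
  qed
  have "(\<lambda>n. 2 * (ennreal (a\<^sup>2) * ?D1 n)) \<longlonglongrightarrow> 2 * (ennreal (a\<^sup>2) * 0)"
    by (intro ennreal_tendsto_cmult l1) simp_all
  moreover have "(\<lambda>n. 2 * (ennreal (b\<^sup>2) * ?D2 n)) \<longlonglongrightarrow> 2 * (ennreal (b\<^sup>2) * 0)"
    by (intro ennreal_tendsto_cmult l2) simp_all
  ultimately have lim: "(\<lambda>n. 2 * (ennreal (a\<^sup>2) * ?D1 n) + 2 * (ennreal (b\<^sup>2) * ?D2 n)) \<longlonglongrightarrow>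
      2 * (ennreal (a\<^sup>2) * 0) + 2 * (ennreal (b\<^sup>2) * 0)"
    by (rule tendsto_add)
  have "(\<lambda>n. \<integral>\<^sup>+\<xi>. ennreal ((cmod (trunc_fourier ?f n \<xi> - ?g \<xi>))\<^sup>2) \<partial>lborel) \<longlonglongrightarrow> 0"
  proof (rule tendsto_sandwich[OF always_eventually always_eventually tendsto_const])
    show "(\<lambda>n. 2 * (ennreal (a\<^sup>2) * ?D1 n) + 2 * (ennreal (b\<^sup>2) * ?D2 n)) \<longlonglongrightarrow> 0"
      using lim by (simp only: mult_zero_right add_0_right)
  qed (intro allI zero_le le)+
  with f' g' show ?thesis
    unfolding has_L2_fourier_trunc by auto
qed

text \<open>\<open>L2_fourier\<close> is an arbitrary choice, so only this uniqueness ties the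
  transform chosen for a linear combination to those chosen for its terms. The distance of
  \<open>g1\<close> and \<open>g2\<close> is independent of \<open>n\<close> but bounded by
  quantities that vanish as \<open>n\<close> grows.\<close>

lemma has_L2_fourier_unique:
  assumes "has_L2_fourier f g1" "has_L2_fourier f g2"
  shows "AE \<xi> in lborel. g1 \<xi> = g2 \<xi>"
proof -
  have [measurable]: "f \<in> borel_measurable borel"
      "g1 \<in> borel_measurable borel" "g2 \<in> borel_measurable borel"
    and l1: "(\<lambda>n. \<integral>\<^sup>+\<xi>. ennreal ((cmod (trunc_fourier f n \<xi> - g1 \<xi>))\<^sup>2) \<partial>lborel) \<longlonglongrightarrow> 0"
    and l2: "(\<lambda>n. \<integral>\<^sup>+\<xi>. ennreal ((cmod (trunc_fourier f n \<xi> - g2 \<xi>))\<^sup>2) \<partial>lborel) \<longlonglongrightarrow> 0"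
    using assms unfolding has_L2_fourier_trunc by auto
  let ?D1 = "\<lambda>n. \<integral>\<^sup>+\<xi>. ennreal ((cmod (trunc_fourier f n \<xi> - g1 \<xi>))\<^sup>2) \<partial>lborel"
  let ?D2 = "\<lambda>n. \<integral>\<^sup>+\<xi>. ennreal ((cmod (trunc_fourier f n \<xi> - g2 \<xi>))\<^sup>2) \<partial>lborel"
  have le: "(\<integral>\<^sup>+\<xi>. ennreal ((cmod (g1 \<xi> - g2 \<xi>))\<^sup>2) \<partial>lborel) \<le> 2 * ?D1 n + 2 * ?D2 n" for n
  proof -
    have "(\<integral>\<^sup>+\<xi>. ennreal ((cmod (g1 \<xi> - g2 \<xi>))\<^sup>2) \<partial>lborel) =
      (\<integral>\<^sup>+\<xi>. ennreal ((cmod ((g1 \<xi> - trunc_fourier f n \<xi>) + (trunc_fourier f n \<xi> - g2 \<xi>)))\<^sup>2) \<partial>lborel)"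
      by simp
    also have "\<dots> \<le> 2 * (\<integral>\<^sup>+\<xi>. ennreal ((cmod (g1 \<xi> - trunc_fourier f n \<xi>))\<^sup>2) \<partial>lborel) + 2 * ?D2 n"
      by (rule nn_integral_norm_sum_squared_le) measurable
    finally show ?thesis
      by (simp add: norm_minus_commute)
  qed
  have "(\<lambda>n. 2 * ?D1 n) \<longlonglongrightarrow> 2 * 0"
    by (intro ennreal_tendsto_cmult l1) simp_all
  moreover have "(\<lambda>n. 2 * ?D2 n) \<longlonglongrightarrow> 2 * 0"
    by (intro ennreal_tendsto_cmult l2) simp_all
  ultimately have "(\<lambda>n. 2 * ?D1 n + 2 * ?D2 n) \<longlonglongrightarrow> 2 * 0 + 2 * 0"
    by (rule tendsto_add)
  then have "(\<integral>\<^sup>+\<xi>. ennreal ((cmod (g1 \<xi> - g2 \<xi>))\<^sup>2) \<partial>lborel) \<le> 0"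
    using le by (intro tendsto_lowerbound) auto
  then have "(\<integral>\<^sup>+\<xi>. ennreal ((cmod (g1 \<xi> - g2 \<xi>))\<^sup>2) \<partial>lborel) = 0"
    by simp
  then have "AE \<xi> in lborel. ennreal ((cmod (g1 \<xi> - g2 \<xi>))\<^sup>2) = 0"
    by (subst (asm) nn_integral_0_iff_AE) auto
  then show ?thesis
    by eventually_elim simp
qed

section \<open>Fourier inversion\<close>

text \<open>After the substitution z = \<epsilon> \<xi> this is the characteristic function of the
  standard normal distribution at s / \<epsilon>.\<close>

lemma gaussian_integral_cis:
  assumes "\<epsilon> > 0"
  shows "(LINT \<xi>|lborel. cis (s * \<xi>) * complex_of_real (std_normal_density (\<epsilon> * \<xi>))) =
    complex_of_real (exp (- (s / \<epsilon>)\<^sup>2 / 2) / \<epsilon>)"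
proof -
  let ?h = "\<lambda>z. cis (s / \<epsilon> * z) * complex_of_real (std_normal_density z)"
  have "(LINT z|lborel. ?h z) = char std_normal_distribution (s / \<epsilon>)"
    unfolding char_def
    by (subst integral_density) (auto simp: cis_conv_exp scaleR_conv_of_real mult_ac intro!: Bochner_Integration.integral_cong)
  also have "\<dots> = complex_of_real (exp (- (s / \<epsilon>)\<^sup>2 / 2))"
    by (simp add: char_std_normal_distribution)
  finally have "complex_of_real (exp (- (s / \<epsilon>)\<^sup>2 / 2)) = \<epsilon> *\<^sub>R (LINT \<xi>|lborel. ?h (0 + \<epsilon> * \<xi>))"
    using lborel_integral_real_affine[of \<epsilon> ?h 0] assms by simp
  then show ?thesis
    using assms by (simp add: scaleR_conv_of_real field_simps)
qed

lemma trunc_fourier_bounded: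
  "norm (trunc_fourier f n \<xi>) \<le> (LINT x|lborel. \<bar>indicator {- real n..real n} x * f x\<bar>)"
proof -
  have "norm (trunc_fourier f n \<xi>) \<le> (LINT x|lborel. norm (indicator {- real n..real n} x *\<^sub>R (complex_of_real (f x) * cis (- (x * \<xi>)))))"
    unfolding trunc_fourier_def set_lebesgue_integral_def by (rule integral_norm_bound)
  then show ?thesis
    by (simp add: norm_mult abs_mult)
qed

text \<open>Fubini moves the transform from \<open>f\<close> to the weight. The double integral
  converges absolutely because the truncation is integrable in \<open>y\<close> and \<open>w\<close>
  in \<xi>; \<open>w\<close> may be any integrable weight, a Gaussian in the application.\<close>

lemma trunc_fourier_gaussian:
  assumes [measurable]: "f \<in> borel_measurable borel" and f2: "integrable lborel (\<lambda>x. (f x)\<^sup>2)"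
    and w: "integrable lborel (w :: real \<Rightarrow> complex)"
  shows "(LINT \<xi>|lborel. trunc_fourier f n \<xi> * w \<xi>) =
    (LINT y|lborel. complex_of_real (indicator {- real n..real n} y * f y) * (LINT \<xi>|lborel. cis (- (y * \<xi>)) * w \<xi>))"
proof -
  have [measurable]: "w \<in> borel_measurable borel"
    using w by auto
  let ?b = "\<lambda>y. indicator {- real n..real n} y * f y"
  let ?K = "\<lambda>y \<xi>. complex_of_real (?b y) * (cis (- (y * \<xi>)) * w \<xi>)"
  have int: "integrable (lborel \<Otimes>\<^sub>M lborel) (case_prod ?K)"
  proof (rule lborel_pair.Fubini_integrable)
    show "integrable lborel (\<lambda>y. LINT \<xi>|lborel. norm (case_prod ?K (y, \<xi>)))"
      using integrable_norm[OF integrable_truncation[OF assms(1,2), of n]]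
      by (simp add: norm_mult abs_mult)
    show "AE y in lborel. integrable lborel (\<lambda>\<xi>. case_prod ?K (y, \<xi>))"
    proof (rule AE_I2)
      fix y
      have "integrable lborel (\<lambda>\<xi>. cis (- (y * \<xi>)) * w \<xi>)"
        by (rule Bochner_Integration.integrable_bound[OF w]) (auto simp: norm_mult)
      then show "integrable lborel (\<lambda>\<xi>. case_prod ?K (y, \<xi>))"
        by simp
    qed
  qed measurable
  have "(LINT \<xi>|lborel. trunc_fourier f n \<xi> * w \<xi>) = (LINT \<xi>|lborel. (LINT y|lborel. ?K y \<xi>))"
  proof (rule Bochner_Integration.integral_cong[OF refl])
    fix \<xi>
    have "trunc_fourier f n \<xi> * w \<xi> =
        (LINT y|lborel. (indicator {- real n..real n} y *\<^sub>R (complex_of_real (f y) * cis (- (y * \<xi>)))) * w \<xi>)"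
      unfolding trunc_fourier_def set_lebesgue_integral_def by (simp only: integral_mult_left_zero)
    also have "\<dots> = (LINT y|lborel. ?K y \<xi>)"
      by (intro Bochner_Integration.integral_cong) (auto simp: scaleR_conv_of_real mult_ac)
    finally show "trunc_fourier f n \<xi> * w \<xi> = (LINT y|lborel. ?K y \<xi>)" .
  qed
  also have "\<dots> = (LINT y|lborel. (LINT \<xi>|lborel. ?K y \<xi>))"
    by (rule lborel_pair.Fubini_integral[OF int])
  also have "\<dots> = (LINT y|lborel. complex_of_real (?b y) * (LINT \<xi>|lborel. cis (- (y * \<xi>)) * w \<xi>))"
    by (simp only: integral_mult_right_zero)
  finally show ?thesis .
qed

text \<open>The transforms converge in L2 and \<open>w\<close> is square integrable, so
  Cauchy-Schwarz makes the pairings converge.\<close>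

lemma tendsto_integral_trunc_fourier:
  assumes "has_L2_fourier f g" and g: "integrable lborel (\<lambda>\<xi>. g \<xi> * w \<xi>)"
    and w: "integrable lborel (w :: real \<Rightarrow> complex)" and w2: "integrable lborel (\<lambda>\<xi>. (cmod (w \<xi>))\<^sup>2)"
  shows "(\<lambda>n. LINT \<xi>|lborel. trunc_fourier f n \<xi> * w \<xi>) \<longlonglongrightarrow> (LINT \<xi>|lborel. g \<xi> * w \<xi>)"
proof -
  have [measurable]: "w \<in> borel_measurable borel"
    using w by auto
  have [measurable]: "f \<in> borel_measurable borel" "g \<in> borel_measurable borel"
    and lim: "(\<lambda>n. \<integral>\<^sup>+\<xi>. ennreal ((cmod (trunc_fourier f n \<xi> - g \<xi>))\<^sup>2) \<partial>lborel) \<longlonglongrightarrow> 0"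
    using assms(1) unfolding has_L2_fourier_trunc by auto
  let ?D = "\<lambda>n. \<integral>\<^sup>+\<xi>. ennreal ((cmod (trunc_fourier f n \<xi> - g \<xi>))\<^sup>2) \<partial>lborel"
  let ?I = "\<lambda>n. LINT \<xi>|lborel. trunc_fourier f n \<xi> * w \<xi>"
  let ?J = "LINT \<xi>|lborel. g \<xi> * w \<xi>"
  let ?W = "LINT \<xi>|lborel. (cmod (w \<xi>))\<^sup>2"
  have i: "integrable lborel (\<lambda>\<xi>. trunc_fourier f n \<xi> * w \<xi>)" for n
  proof (rule Bochner_Integration.integrable_bound)
    let ?B = "LINT x|lborel. \<bar>indicator {- real n..real n} x * f x\<bar>"
    show "integrable lborel (\<lambda>\<xi>. ?B * norm (w \<xi>))"
      using w by auto
    show "AE \<xi> in lborel. norm (trunc_fourier f n \<xi> * w \<xi>) \<le> norm (?B * norm (w \<xi>))"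
      using trunc_fourier_bounded[of f n]
      by (auto simp: norm_mult intro!: mult_right_mono order_trans[OF _ abs_ge_self])
  qed measurable
  \<comment> \<open>Estimated in \<open>ennreal\<close>, so that no finiteness of
    \<open>?D n\<close> has to be shown for individual \<open>n\<close>.\<close>
  have le: "ennreal ((norm (?I n - ?J))\<^sup>2) \<le> ennreal ?W * ?D n" for n
  proof -
    have "?I n - ?J = (LINT \<xi>|lborel. (trunc_fourier f n \<xi> - g \<xi>) * w \<xi>)"
      using i g by (simp add: left_diff_distrib)
    moreover have "integrable lborel (\<lambda>\<xi>. (trunc_fourier f n \<xi> - g \<xi>) * w \<xi>)"
      using i g by (simp add: left_diff_distrib)
    ultimately have "ennreal (norm (?I n - ?J)) \<le> (\<integral>\<^sup>+\<xi>. norm ((trunc_fourier f n \<xi> - g \<xi>) * w \<xi>) \<partial>lborel)"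
      by (simp add: integral_norm_bound_ennreal)
    also have "\<dots> = (\<integral>\<^sup>+\<xi>. ennreal (cmod (w \<xi>)) * ennreal (cmod (trunc_fourier f n \<xi> - g \<xi>)) \<partial>lborel)"
      by (simp add: norm_mult ennreal_mult mult.commute)
    finally have "(ennreal (norm (?I n - ?J)))\<^sup>2 \<le>
        (\<integral>\<^sup>+\<xi>. ennreal (cmod (w \<xi>)) * ennreal (cmod (trunc_fourier f n \<xi> - g \<xi>)) \<partial>lborel)\<^sup>2"
      by (intro power_mono) auto
    also have "\<dots> \<le> (\<integral>\<^sup>+\<xi>. (ennreal (cmod (w \<xi>)))\<^sup>2 \<partial>lborel) * (\<integral>\<^sup>+\<xi>. (ennreal (cmod (trunc_fourier f n \<xi> - g \<xi>)))\<^sup>2 \<partial>lborel)"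
      by (rule Cauchy_Schwarz_nn_integral) measurable
    also have "\<dots> = ennreal ?W * ?D n"
      using w2 by (simp add: ennreal_power nn_integral_eq_integral)
    finally show ?thesis
      by (simp add: ennreal_power)
  qed
  have "(\<lambda>n. ennreal ((norm (?I n - ?J))\<^sup>2)) \<longlonglongrightarrow> 0"
  proof (rule tendsto_sandwich[OF always_eventually always_eventually tendsto_const])
    have "(\<lambda>n. ennreal ?W * ?D n) \<longlonglongrightarrow> ennreal ?W * 0"
      by (intro ennreal_tendsto_cmult lim) simp
    then show "(\<lambda>n. ennreal ?W * ?D n) \<longlonglongrightarrow> 0"
      by (simp only: mult_zero_right)
  qed (intro allI zero_le le)+
  then have "(\<lambda>n. (norm (?I n - ?J))\<^sup>2) \<longlonglongrightarrow> 0"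
    by (simp flip: ennreal_0 add: tendsto_ennreal_iff)
  then have "(\<lambda>n. norm (?I n - ?J)) \<longlonglongrightarrow> 0"
    using tendsto_real_sqrt by fastforce
  then show ?thesis
    by (simp add: LIM_zero_iff tendsto_norm_zero_iff)
qed

text \<open>Away from its centre the Gaussian is small like \<epsilon>, with a decay that can be
  paired with an L2 function. Put q = (y - x)^2: from exp z >= z with z = q / (2 \<epsilon>^2) and
  sqrt (2 pi) >= 2 follows the bound \<epsilon> / q, and 1 / q <= 2 / (1 + q) because q >=
  1.\<close>

lemma normal_density_far_le:
  assumes "1 \<le> \<bar>y - x\<bar>" "0 < \<epsilon>"
  shows "normal_density x \<epsilon> y \<le> 2 * \<epsilon> * (1 + (y - x)\<^sup>2) powr (- 1)"
proof -
  define q where "q = (y - x)\<^sup>2"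
  have q: "1 \<le> q"
    using assms(1) unfolding q_def by (metis one_le_power power2_abs)
  have "q / (2 * \<epsilon>\<^sup>2) \<le> exp (q / (2 * \<epsilon>\<^sup>2))"
    using exp_ge_add_one_self[of "q / (2 * \<epsilon>\<^sup>2)"] by linarith
  then have e: "exp (- q / (2 * \<epsilon>\<^sup>2)) \<le> 2 * \<epsilon>\<^sup>2 / q"
    using q assms(2) by (simp add: exp_minus field_simps)
  have "2 \<le> sqrt (2 * pi)"
    using pi_gt3 by (intro real_le_rsqrt) auto
  then have s: "1 / sqrt (2 * pi * \<epsilon>\<^sup>2) \<le> 1 / (2 * \<epsilon>)"
    using assms(2) by (auto simp: real_sqrt_mult intro!: divide_left_mono mult_right_mono)
  have "normal_density x \<epsilon> y \<le> 1 / (2 * \<epsilon>) * (2 * \<epsilon>\<^sup>2 / q)"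
    unfolding normal_density_def q_def[symmetric]
    using s e assms(2) by (intro mult_mono) auto
  also have "\<dots> = \<epsilon> * (1 / q)"
    using assms(2) by (simp add: power2_eq_square)
  also have "\<dots> \<le> \<epsilon> * (2 / (1 + q))"
    using q assms(2) by (intro mult_left_mono) (auto simp: field_simps)
  also have "\<dots> = 2 * \<epsilon> * (1 + q) powr (- 1)"
    using q by (simp add: powr_minus_divide)
  finally show ?thesis
    by (simp add: q_def)
qed

text \<open>No global bound on \<open>f\<close> is assumed, so the integral is split at distance 1
  from \<open>x\<close>: nearby \<open>f\<close> is bounded by compactness and dominated convergence
  applies, while far away the smallness of the Gaussian compensates for knowing \<open>f\<close>
  only in L2.\<close>

lemma gaussian_approximate_identity:
  fixes f :: "real \<Rightarrow> real"
  assumes f: "continuous_on UNIV f" and f2: "integrable lborel (\<lambda>x. (f x)\<^sup>2)"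
  shows "(\<lambda>k. LINT y|lborel. f y * normal_density x (1 / real (Suc k)) y) \<longlonglongrightarrow> f x"
    and "\<epsilon> > 0 \<Longrightarrow> integrable lborel (\<lambda>y. f y * normal_density x \<epsilon> y)"
proof -
  have [measurable]: "f \<in> borel_measurable borel"
    using f by (rule borel_measurable_continuous_onI)
  let ?N = "\<lambda>\<epsilon>. normal_density x \<epsilon>"
  let ?near = "\<lambda>\<epsilon> y. indicator {x-1..x+1} y * f y * ?N \<epsilon> y"
  let ?far = "\<lambda>\<epsilon> y. indicator (- {x-1..x+1}) y * f y * ?N \<epsilon> y"
  obtain B where B: "\<And>y. y \<in> {x-1..x+1} \<Longrightarrow> \<bar>f y\<bar> \<le> B"
  proof -
    have "bounded (f ` {x-1..x+1})"
      using f by (intro compact_imp_bounded compact_continuous_image continuous_on_subset[OF f]) auto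
    then show ?thesis
      by (auto simp: bounded_iff intro: that)
  qed
  have B0: "0 \<le> B"
    using B[of x] by auto
  have near_int: "integrable lborel (?near \<epsilon>)" if "\<epsilon> > 0" for \<epsilon>
  proof (rule Bochner_Integration.integrable_bound)
    show "integrable lborel (\<lambda>y. B * ?N \<epsilon> y)"
      using that by auto
    show "AE y in lborel. norm (?near \<epsilon> y) \<le> norm (B * ?N \<epsilon> y)"
      using B B0 by (auto simp: abs_mult indicator_def intro!: mult_right_mono)
  qed measurable
  \<comment> \<open>From 2 |f| w <= f^2 + w^2 and w <= 1, where w is the weight of
    \<open>normal_density_far_le\<close>: the far part is at most \<epsilon> times this integrable
    function, which is independent of \<epsilon>.\<close>
  define G where "G = (\<lambda>y. (f y)\<^sup>2 + (1 + (y - x)\<^sup>2) powr (- 1))"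
  have W: "integrable lborel (\<lambda>y. (1 + (y - x)\<^sup>2) powr (- 1))"
    using lborel_integrable_real_affine[OF integrable_powr_weight[of 1], of 1 "- x"] by simp
  have G: "integrable lborel G"
    unfolding G_def using f2 W by (intro Bochner_Integration.integrable_add)
  have far_le: "norm (?far \<epsilon> y) \<le> \<epsilon> * G y" if "\<epsilon> > 0" for \<epsilon> y
  proof (cases "y \<in> {x-1..x+1}")
    case False
    let ?w = "(1 + (y - x)\<^sup>2) powr (- 1)"
    have w: "?w * ?w \<le> ?w"
      using mult_left_le_one_le[of ?w ?w] by (simp add: powr_minus inverse_le_1_iff)
    have "norm (?far \<epsilon> y) = \<bar>f y\<bar> * ?N \<epsilon> y"
      using False by (simp add: abs_mult)
    also have "\<dots> \<le> \<bar>f y\<bar> * (2 * \<epsilon> * ?w)"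
      using False that by (intro mult_left_mono normal_density_far_le) auto
    also have "\<dots> = \<epsilon> * (2 * \<bar>f y\<bar> * ?w)"
      by simp
    also have "\<dots> \<le> \<epsilon> * ((f y)\<^sup>2 + ?w * ?w)"
      using that sum_squares_bound[of "\<bar>f y\<bar>" ?w] by (intro mult_left_mono) (auto simp: power2_eq_square)
    also have "\<dots> \<le> \<epsilon> * G y"
      unfolding G_def using that w by (intro mult_left_mono) auto
    finally show ?thesis .
  qed (use that in \<open>auto simp: G_def\<close>)
  have far_int: "integrable lborel (?far \<epsilon>)" if "\<epsilon> > 0" for \<epsilon>
  proof (rule Bochner_Integration.integrable_bound)
    show "integrable lborel (\<lambda>y. \<epsilon> * G y)"
      using G by auto
    show "AE y in lborel. norm (?far \<epsilon> y) \<le> norm (\<epsilon> * G y)"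
      using order_trans[OF far_le[OF that] abs_ge_self] by simp
  qed measurable
  have split: "f y * ?N \<epsilon> y = ?near \<epsilon> y + ?far \<epsilon> y" for \<epsilon> y
    by (auto simp: indicator_def)
  show "integrable lborel (\<lambda>y. f y * ?N \<epsilon> y)" if "\<epsilon> > 0" for \<epsilon>
    unfolding split using near_int[OF that] far_int[OF that] by (rule Bochner_Integration.integrable_add)
  have near_lim: "(\<lambda>k. LINT y|lborel. ?near (1 / real (Suc k)) y) \<longlonglongrightarrow> f x"
  proof -
    \<comment> \<open>Substituting y = x + z / (k + 1) freezes the density, so that
      \<open>B * std_normal_density z\<close> dominates for every \<open>k\<close>.\<close>
    let ?h = "\<lambda>k z. indicator {x-1..x+1} (x + 1 / real (Suc k) * z) * f (x + 1 / real (Suc k) * z) * std_normal_density z"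
    have "(LINT y|lborel. ?near (1 / real (Suc k)) y) = (LINT z|lborel. ?h k z)" for k
    proof -
      have e: "1 / real (Suc k) > 0" by simp
      have "(LINT y|lborel. ?near (1 / real (Suc k)) y) = (1 / real (Suc k)) *
          (LINT z|lborel. ?near (1 / real (Suc k)) (x + 1 / real (Suc k) * z))"
        using lborel_integral_real_affine[of "1 / real (Suc k)" "?near (1 / real (Suc k))" x] by simp
      also have "\<dots> = (LINT z|lborel. 1 / real (Suc k) * ?near (1 / real (Suc k)) (x + 1 / real (Suc k) * z))"
        by (simp only: integral_mult_right_zero)
      also have "\<dots> = (LINT z|lborel. ?h k z)"
      proof (rule Bochner_Integration.integral_cong[OF refl])
        fix z
        have n: "1 / real (Suc k) * ?N (1 / real (Suc k)) (x + 1 / real (Suc k) * z) = std_normal_density z"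
          unfolding normal_density_def by (simp add: real_sqrt_mult power_divide real_sqrt_divide field_simps del: of_nat_Suc)
        have "e * (a * b * d) = a * b * (e * d)" for e a b d :: real
          by simp
        then show "1 / real (Suc k) * ?near (1 / real (Suc k)) (x + 1 / real (Suc k) * z) = ?h k z"
          by (simp only: n)
      qed
      finally show ?thesis .
    qed
    moreover have "(\<lambda>k. LINT z|lborel. ?h k z) \<longlonglongrightarrow> (LINT z|lborel. f x * std_normal_density z)"
    proof (rule integral_dominated_convergence)
      show "integrable lborel (\<lambda>z. B * std_normal_density z)"
        by auto
      show "AE z in lborel. (\<lambda>k. ?h k z) \<longlonglongrightarrow> f x * std_normal_density z"
      proof (rule AE_I2)
        fix z
        have t0: "(\<lambda>k. 1 / real (Suc k) * z) \<longlonglongrightarrow> 0 * z"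
          using LIMSEQ_inverse_real_of_nat by (intro tendsto_mult tendsto_const) (simp add: field_simps)
        have t1: "(\<lambda>k. x + 1 / real (Suc k) * z) \<longlonglongrightarrow> x"
          using tendsto_add[OF tendsto_const[of x] t0] by simp
        have "isCont f x"
          using f by (simp add: continuous_on_eq_continuous_at)
        then have t2: "(\<lambda>k. f (x + 1 / real (Suc k) * z)) \<longlonglongrightarrow> f x"
          using t1 isCont_tendsto_compose by blast
        have "\<forall>\<^sub>F k in sequentially. x + 1 / real (Suc k) * z \<in> {x-1<..<x+1}"
          by (rule topological_tendstoD[OF t1]) auto
        then have "\<forall>\<^sub>F k in sequentially. f (x + 1 / real (Suc k) * z) * std_normal_density z = ?h k z"
          by eventually_elim auto
        then show "(\<lambda>k. ?h k z) \<longlonglongrightarrow> f x * std_normal_density z"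
          by (rule Lim_transform_eventually[rotated]) (intro tendsto_mult t2 tendsto_const)
      qed
      show "AE z in lborel. norm (?h k z) \<le> B * std_normal_density z" for k
        using B B0 by (auto simp: abs_mult indicator_def intro!: mult_right_mono)
    qed measurable
    ultimately show ?thesis
      by simp
  qed
  have far_lim: "(\<lambda>k. LINT y|lborel. ?far (1 / real (Suc k)) y) \<longlonglongrightarrow> 0"
  proof (rule Lim_null_comparison)
    show "(\<lambda>k. 1 / real (Suc k) * (LINT y|lborel. G y)) \<longlonglongrightarrow> 0"
      using tendsto_mult[OF LIMSEQ_inverse_real_of_nat tendsto_const] by (simp add: field_simps)
    show "\<forall>\<^sub>F k in sequentially. norm (LINT y|lborel. ?far (1 / real (Suc k)) y) \<le> 1 / real (Suc k) * (LINT y|lborel. G y)"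
    proof (intro always_eventually allI)
      fix k
      have e: "1 / real (Suc k) > 0" by simp
      have "norm (LINT y|lborel. ?far (1 / real (Suc k)) y) \<le> (LINT y|lborel. 1 / real (Suc k) * G y)"
        by (rule Bochner_Integration.integral_norm_bound_integral[OF far_int[OF e] _ far_le[OF e]]) (use G in auto)
      then show "norm (LINT y|lborel. ?far (1 / real (Suc k)) y) \<le> 1 / real (Suc k) * (LINT y|lborel. G y)"
        by (simp only: integral_mult_right_zero)
    qed
  qed
  have "(LINT y|lborel. f y * ?N (1 / real (Suc k)) y) =
      (LINT y|lborel. ?near (1 / real (Suc k)) y) + (LINT y|lborel. ?far (1 / real (Suc k)) y)" for k
    unfolding split by (intro Bochner_Integration.integral_add near_int far_int) auto
  then show "(\<lambda>k. LINT y|lborel. f y * ?N (1 / real (Suc k)) y) \<longlonglongrightarrow> f x"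
    using tendsto_add[OF near_lim far_lim] by simp
qed

text \<open>
  Both sides of the inversion formula are tested against a Gaussian, whose transform is known;
  the Gaussian is then contracted to a point mass at \<open>x\<close>.
\<close>

theorem L2_fourier_inversion:
  assumes f: "continuous_on UNIV f" and fg: "has_L2_fourier f g" and g: "integrable lborel g"
  shows "complex_of_real (f x) = (LINT \<xi>|lborel. g \<xi> * cis (x * \<xi>)) / complex_of_real (2 * pi)"
proof -
  have [measurable]: "f \<in> borel_measurable borel" "g \<in> borel_measurable borel"
    and f2: "integrable lborel (\<lambda>x. (f x)\<^sup>2)"
    using fg unfolding has_L2_fourier_trunc by auto
  \<comment> \<open>The factor \<open>cis (x * \<xi>)\<close> centres the transformed Gaussian at
    \<open>x\<close>. As \<epsilon> tends to 0, the Gaussian itself flattens to the constant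
    \<open>std_normal_density 0\<close>.\<close>
  let ?w = "\<lambda>\<epsilon> \<xi>. cis (x * \<xi>) * complex_of_real (std_normal_density (\<epsilon> * \<xi>))"
  have d1: "std_normal_density z \<le> 1" for z
  proof -
    have "1 \<le> sqrt (2 * pi)"
      using pi_gt3 by simp
    then show ?thesis
      by (auto simp: std_normal_density_def field_simps intro: order_trans[of _ 1])
  qed
  have nd: "integrable lborel (\<lambda>\<xi>. std_normal_density (\<epsilon> * \<xi>))" if "\<epsilon> > 0" for \<epsilon>
    using lborel_integrable_real_affine[of std_normal_density \<epsilon> 0] that by auto
  have w: "integrable lborel (?w \<epsilon>)" if "\<epsilon> > 0" for \<epsilon>
    by (rule Bochner_Integration.integrable_bound[OF nd[OF that]]) (auto simp: norm_mult)
  have w2: "integrable lborel (\<lambda>\<xi>. (cmod (?w \<epsilon> \<xi>))\<^sup>2)" if "\<epsilon> > 0" for \<epsilon>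
    by (rule Bochner_Integration.integrable_bound[OF nd[OF that]])
      (auto simp: norm_mult power2_eq_square intro!: mult_left_le_one_le d1)
  have gw: "integrable lborel (\<lambda>\<xi>. g \<xi> * ?w \<epsilon> \<xi>)" for \<epsilon>
    by (rule Bochner_Integration.integrable_bound[OF g]) (auto simp: norm_mult intro!: mult_left_le d1)
  \<comment> \<open>One sequence, two limits: the pairings of the truncated transforms tend to the
    pairing of \<open>g\<close> by L2 convergence, and by Fubini they are Gaussian averages of
    truncations of \<open>f\<close>.\<close>
  have eq: "(LINT \<xi>|lborel. g \<xi> * ?w \<epsilon> \<xi>) =
      complex_of_real (sqrt (2 * pi) * (LINT y|lborel. f y * normal_density x \<epsilon> y))"
    if e: "\<epsilon> > 0" for \<epsilon>
  proof (rule LIMSEQ_unique)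
    show "(\<lambda>n. LINT \<xi>|lborel. trunc_fourier f n \<xi> * ?w \<epsilon> \<xi>) \<longlonglongrightarrow> (LINT \<xi>|lborel. g \<xi> * ?w \<epsilon> \<xi>)"
      by (rule tendsto_integral_trunc_fourier[OF fg gw w[OF e] w2[OF e]])
    have tr: "(LINT \<xi>|lborel. trunc_fourier f n \<xi> * ?w \<epsilon> \<xi>) =
        complex_of_real (sqrt (2 * pi) * (LINT y|lborel. indicator {- real n..real n} y * (f y * normal_density x \<epsilon> y)))" for n
    proof -
      have "(LINT \<xi>|lborel. cis (- (y * \<xi>)) * ?w \<epsilon> \<xi>) = complex_of_real (sqrt (2 * pi) * normal_density x \<epsilon> y)" for y
      proof -
        have "(LINT \<xi>|lborel. cis (- (y * \<xi>)) * ?w \<epsilon> \<xi>) =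
            (LINT \<xi>|lborel. cis ((x - y) * \<xi>) * complex_of_real (std_normal_density (\<epsilon> * \<xi>)))"
          by (intro Bochner_Integration.integral_cong) (auto simp: cis_mult algebra_simps simp flip: mult.assoc)
        also have "\<dots> = complex_of_real (sqrt (2 * pi) * normal_density x \<epsilon> y)"
          using e by (subst gaussian_integral_cis)
            (auto simp: normal_density_def real_sqrt_mult power_divide power2_commute field_simps)
        finally show ?thesis .
      qed
      then have "(LINT \<xi>|lborel. trunc_fourier f n \<xi> * ?w \<epsilon> \<xi>) = (LINT y|lborel.
          complex_of_real (sqrt (2 * pi) * (indicator {- real n..real n} y * (f y * normal_density x \<epsilon> y))))"
        by (subst trunc_fourier_gaussian[OF _ f2 w[OF e]]) (auto simp: mult_ac)
      then show ?thesis
        by (simp only: integral_complex_of_real integral_mult_right_zero)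
    qed
    have "(\<lambda>n. LINT y|lborel. indicator {- real n..real n} y * (f y * normal_density x \<epsilon> y)) \<longlonglongrightarrow>
        (LINT y|lborel. f y * normal_density x \<epsilon> y)"
    proof (rule integral_dominated_convergence)
      show "integrable lborel (\<lambda>y. norm (f y * normal_density x \<epsilon> y))"
        using gaussian_approximate_identity(2)[OF f f2 e] by (rule integrable_norm)
      show "AE y in lborel. (\<lambda>n. indicator {- real n..real n} y * (f y * normal_density x \<epsilon> y))
          \<longlonglongrightarrow> f y * normal_density x \<epsilon> y"
      proof (rule AE_I2)
        fix y
        obtain m :: nat where "\<bar>y\<bar> \<le> real m"
          using real_arch_simple by blast
        then have "\<forall>\<^sub>F n in sequentially. indicator {- real n..real n} y * (f y * normal_density x \<epsilon> y) = f y * normal_density x \<epsilon> y"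
          by (auto simp: eventually_sequentially indicator_def intro!: exI[of _ m])
        then show "(\<lambda>n. indicator {- real n..real n} y * (f y * normal_density x \<epsilon> y)) \<longlonglongrightarrow> f y * normal_density x \<epsilon> y"
          by (rule tendsto_eventually)
      qed
    qed (auto simp: indicator_def)
    then show "(\<lambda>n. LINT \<xi>|lborel. trunc_fourier f n \<xi> * ?w \<epsilon> \<xi>) \<longlonglongrightarrow>
        complex_of_real (sqrt (2 * pi) * (LINT y|lborel. f y * normal_density x \<epsilon> y))"
      unfolding tr by (intro tendsto_of_real tendsto_mult tendsto_const)
  qed
  have eq': "(LINT \<xi>|lborel. g \<xi> * ?w (1 / real (Suc k)) \<xi>) =
      complex_of_real (sqrt (2 * pi) * (LINT y|lborel. f y * normal_density x (1 / real (Suc k)) y))" for k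
    by (rule eq) simp
  have "(\<lambda>k. LINT \<xi>|lborel. g \<xi> * ?w (1 / real (Suc k)) \<xi>) \<longlonglongrightarrow> complex_of_real (sqrt (2 * pi) * f x)"
    unfolding eq' by (intro tendsto_of_real tendsto_mult tendsto_const gaussian_approximate_identity(1)[OF f f2])
  moreover have "(\<lambda>k. LINT \<xi>|lborel. g \<xi> * ?w (1 / real (Suc k)) \<xi>) \<longlonglongrightarrow>
      (LINT \<xi>|lborel. g \<xi> * (cis (x * \<xi>) * complex_of_real (std_normal_density 0)))"
  proof (rule integral_dominated_convergence)
    show "integrable lborel (\<lambda>\<xi>. norm (g \<xi>))"
      using g by auto
    show "AE \<xi> in lborel. (\<lambda>k. g \<xi> * ?w (1 / real (Suc k)) \<xi>) \<longlonglongrightarrow>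
        g \<xi> * (cis (x * \<xi>) * complex_of_real (std_normal_density 0))"
    proof (rule AE_I2)
      fix \<xi>
      have t0: "(\<lambda>k. 1 / real (Suc k) * \<xi>) \<longlonglongrightarrow> 0 * \<xi>"
        using LIMSEQ_inverse_real_of_nat by (intro tendsto_mult tendsto_const) (simp add: field_simps)
      have "isCont std_normal_density 0"
        unfolding normal_density_def by (intro continuous_intros) auto
      then have "(\<lambda>k. std_normal_density (1 / real (Suc k) * \<xi>)) \<longlonglongrightarrow> std_normal_density 0"
        using t0 isCont_tendsto_compose[of 0 std_normal_density] by simp
      then show "(\<lambda>k. g \<xi> * ?w (1 / real (Suc k)) \<xi>) \<longlonglongrightarrow>
        g \<xi> * (cis (x * \<xi>) * complex_of_real (std_normal_density 0))"
        by (intro tendsto_mult tendsto_const tendsto_of_real)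
    qed
    show "AE \<xi> in lborel. norm (g \<xi> * ?w (1 / real (Suc k)) \<xi>) \<le> norm (g \<xi>)" for k
      by (auto simp: norm_mult intro!: mult_left_le d1)
  qed measurable
  ultimately have "complex_of_real (sqrt (2 * pi) * f x) =
      (LINT \<xi>|lborel. g \<xi> * (cis (x * \<xi>) * complex_of_real (std_normal_density 0)))"
    by (rule LIMSEQ_unique)
  also have "\<dots> = (LINT \<xi>|lborel. g \<xi> * cis (x * \<xi>)) * complex_of_real (1 / sqrt (2 * pi))"
    by (simp add: std_normal_density_def flip: mult.assoc)
  \<comment> \<open>One factor \<open>sqrt (2 * pi)\<close> stems from the transform of the
    Gaussian, the other from \<open>std_normal_density 0\<close>; together they give the 2 pi of the
    formula.\<close>
  finally have "complex_of_real (sqrt (2 * pi)) * complex_of_real (sqrt (2 * pi) * f x) = (LINT \<xi>|lborel. g \<xi> * cis (x * \<xi>))"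
    by (simp add: field_simps)
  moreover have "complex_of_real (sqrt (2 * pi)) * complex_of_real (sqrt (2 * pi) * f x) = complex_of_real (2 * pi) * complex_of_real (f x)"
    by (simp flip: of_real_mult mult.assoc)
  ultimately show ?thesis
    by (simp add: field_simps)
qed

section \<open>Sobolev embedding\<close>

lemma isCont_integral_cis:
  assumes h: "integrable lborel (h :: real \<Rightarrow> complex)"
  shows "isCont (\<lambda>x. LINT \<xi>|lborel. h \<xi> * cis (x * \<xi>)) x"
proof (rule continuous_at_sequentiallyI)
  fix S :: "nat \<Rightarrow> real"
  assume S: "S \<longlonglongrightarrow> x"
  have [measurable]: "h \<in> borel_measurable borel"
    using h by auto
  show "(\<lambda>n. LINT \<xi>|lborel. h \<xi> * cis (S n * \<xi>)) \<longlonglongrightarrow> (LINT \<xi>|lborel. h \<xi> * cis (x * \<xi>))"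
  proof (rule integral_dominated_convergence)
    show "integrable lborel (\<lambda>\<xi>. norm (h \<xi>))"
      using h by auto
    show "AE \<xi> in lborel. (\<lambda>n. h \<xi> * cis (S n * \<xi>)) \<longlonglongrightarrow> h \<xi> * cis (x * \<xi>)"
      by (intro AE_I2 tendsto_intros S)
  qed (auto simp: norm_mult)
qed

lemma norm_cis_diff_le: "cmod (cis a - cis b) \<le> \<bar>a - b\<bar>"
proof -
  have "cis a - cis b = cis b * (cis (a - b) - 1)"
    by (simp add: algebra_simps cis_mult)
  then have "cmod (cis a - cis b) = cmod (cis (a - b) - 1)"
    by (simp add: norm_mult)
  also have "\<dots> \<le> \<bar>a - b\<bar>"
    using iexp_approx1[of "a - b" 0] by (simp add: cis_conv_exp)
  finally show ?thesis .
qed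

text \<open>Differentiation under the integral, dominated by |\<xi> g|. It is phrased with
  difference quotients because the variable is real and the value complex; \<open>sobolev_C1\<close>
  takes the real part of these quotients.\<close>

lemma integral_cis_has_derivative:
  assumes g: "integrable lborel (g :: real \<Rightarrow> complex)"
    and xg: "integrable lborel (\<lambda>\<xi>. \<i> * complex_of_real \<xi> * g \<xi>)"
  shows "((\<lambda>h. ((LINT \<xi>|lborel. g \<xi> * cis ((x + h) * \<xi>)) - (LINT \<xi>|lborel. g \<xi> * cis (x * \<xi>))) / complex_of_real h)
    \<longlongrightarrow> (LINT \<xi>|lborel. \<i> * complex_of_real \<xi> * g \<xi> * cis (x * \<xi>))) (at 0)"
proof (subst LIMSEQ_SEQ_conv[symmetric], intro allI impI, elim conjE)
  fix S :: "nat \<Rightarrow> real"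
  assume S0: "\<forall>n. S n \<noteq> 0" and S: "S \<longlonglongrightarrow> 0"
  have [measurable]: "g \<in> borel_measurable borel"
    using g by auto
  have gc: "integrable lborel (\<lambda>\<xi>. g \<xi> * cis (y * \<xi>))" for y
    by (rule Bochner_Integration.integrable_bound[OF g]) (auto simp: norm_mult)
  let ?q = "\<lambda>n \<xi>. g \<xi> * ((cis ((x + S n) * \<xi>) - cis (x * \<xi>)) / complex_of_real (S n))"
  have "((LINT \<xi>|lborel. g \<xi> * cis ((x + S n) * \<xi>)) - (LINT \<xi>|lborel. g \<xi> * cis (x * \<xi>))) / complex_of_real (S n) =
      (LINT \<xi>|lborel. ?q n \<xi>)" for n
  proof -
    have "(LINT \<xi>|lborel. ?q n \<xi>) = (LINT \<xi>|lborel. (g \<xi> * cis ((x + S n) * \<xi>) - g \<xi> * cis (x * \<xi>)) / complex_of_real (S n))"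
      by (intro Bochner_Integration.integral_cong) (auto simp: diff_divide_distrib algebra_simps)
    then show ?thesis
      by (simp only: integral_divide_zero Bochner_Integration.integral_diff[OF gc gc])
  qed
  moreover have "(\<lambda>n. LINT \<xi>|lborel. ?q n \<xi>) \<longlonglongrightarrow> (LINT \<xi>|lborel. \<i> * complex_of_real \<xi> * g \<xi> * cis (x * \<xi>))"
  proof (rule integral_dominated_convergence)
    show "integrable lborel (\<lambda>\<xi>. norm (\<i> * complex_of_real \<xi> * g \<xi>))"
      using xg by (rule integrable_norm)
    show "AE \<xi> in lborel. (\<lambda>n. ?q n \<xi>) \<longlonglongrightarrow> \<i> * complex_of_real \<xi> * g \<xi> * cis (x * \<xi>)"
    proof (rule AE_I2)
      fix \<xi>
      \<comment> \<open>The pointwise limit is the complex derivative of this entire function,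
        evaluated along real increments.\<close>
      let ?e = "\<lambda>z::complex. exp (\<i> * (z * complex_of_real \<xi>))"
      have "(?e has_field_derivative \<i> * complex_of_real \<xi> * ?e (complex_of_real x)) (at (complex_of_real x))"
        by (auto intro!: derivative_eq_intros)
      then have "((\<lambda>h. (?e (complex_of_real x + h) - ?e (complex_of_real x)) / h)
          \<longlongrightarrow> \<i> * complex_of_real \<xi> * ?e (complex_of_real x)) (at 0)"
        by (simp add: DERIV_def)
      moreover have "filterlim (\<lambda>n. complex_of_real (S n)) (at 0) sequentially"
        using tendsto_of_real[OF S] S0 by (simp add: filterlim_at)
      ultimately have "(\<lambda>n. (?e (complex_of_real x + complex_of_real (S n)) - ?e (complex_of_real x)) / complex_of_real (S n))
          \<longlonglongrightarrow> \<i> * complex_of_real \<xi> * ?e (complex_of_real x)"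
        by (rule filterlim_compose)
      then have "(\<lambda>n. (cis ((x + S n) * \<xi>) - cis (x * \<xi>)) / complex_of_real (S n))
          \<longlonglongrightarrow> \<i> * complex_of_real \<xi> * cis (x * \<xi>)"
        by (simp add: cis_conv_exp)
      then have "(\<lambda>n. ?q n \<xi>) \<longlonglongrightarrow> g \<xi> * (\<i> * complex_of_real \<xi> * cis (x * \<xi>))"
        by (intro tendsto_mult tendsto_const)
      then show "(\<lambda>n. ?q n \<xi>) \<longlonglongrightarrow> \<i> * complex_of_real \<xi> * g \<xi> * cis (x * \<xi>)"
        by (simp add: mult_ac)
    qed
    show "AE \<xi> in lborel. norm (?q n \<xi>) \<le> norm (\<i> * complex_of_real \<xi> * g \<xi>)" for n
    proof (rule AE_I2)
      fix \<xi>
      have "cmod (cis ((x + S n) * \<xi>) - cis (x * \<xi>)) \<le> \<bar>S n\<bar> * \<bar>\<xi>\<bar>"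
        using norm_cis_diff_le[of "(x + S n) * \<xi>" "x * \<xi>"] by (simp add: algebra_simps abs_mult)
      then have "cmod (cis ((x + S n) * \<xi>) - cis (x * \<xi>)) / \<bar>S n\<bar> \<le> \<bar>\<xi>\<bar>"
        using S0 by (simp add: field_simps)
      then have "cmod (g \<xi>) * (cmod (cis ((x + S n) * \<xi>) - cis (x * \<xi>)) / \<bar>S n\<bar>) \<le> cmod (g \<xi>) * \<bar>\<xi>\<bar>"
        by (intro mult_left_mono) auto
      then show "norm (?q n \<xi>) \<le> norm (\<i> * complex_of_real \<xi> * g \<xi>)"
        by (simp add: norm_mult norm_divide mult_ac)
    qed
  qed measurable
  ultimately show "(\<lambda>n. ((LINT \<xi>|lborel. g \<xi> * cis ((x + S n) * \<xi>)) - (LINT \<xi>|lborel. g \<xi> * cis (x * \<xi>))) / complex_of_real (S n))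
      \<longlonglongrightarrow> (LINT \<xi>|lborel. \<i> * complex_of_real \<xi> * g \<xi> * cis (x * \<xi>))"
    by (simp only:)
qed

lemma has_L2_fourier_some: "has_L2_fourier f g \<Longrightarrow> has_L2_fourier f (L2_fourier f)"
  unfolding L2_fourier_def by (rule someI[of "has_L2_fourier f"])

lemma has_L2_fourier_L2_fourier:
  "f \<in> sobolev_space s \<Longrightarrow> has_L2_fourier f (L2_fourier f)"
  unfolding sobolev_space_def using has_L2_fourier_some by blast

lemma borel_measurable_L2_fourier:
  "f \<in> sobolev_space s \<Longrightarrow> L2_fourier f \<in> borel_measurable borel"
  using has_L2_fourier_L2_fourier unfolding has_L2_fourier_def by auto

text \<open>Time continuity and time derivative are stated through norms of
  \<open>u \<tau> - u t\<close> and of difference quotients. The sup bounds apply to these functions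
  only once they are known to lie in the space.\<close>

lemma sobolev_space_lincomb:
  assumes f1: "f1 \<in> sobolev_space s" and f2: "f2 \<in> sobolev_space s"
  shows "(\<lambda>x. a * f1 x + b * f2 x) \<in> sobolev_space s"
proof -
  let ?f = "\<lambda>x. a * f1 x + b * f2 x"
  let ?g = "\<lambda>\<xi>. complex_of_real a * L2_fourier f1 \<xi> + complex_of_real b * L2_fourier f2 \<xi>"
  have [measurable]: "L2_fourier f1 \<in> borel_measurable borel" "L2_fourier f2 \<in> borel_measurable borel"
    using f1 f2 borel_measurable_L2_fourier by auto
  have fg: "has_L2_fourier ?f ?g"
    using f1 f2 by (intro has_L2_fourier_lincomb has_L2_fourier_L2_fourier)
  then have L: "has_L2_fourier ?f (L2_fourier ?f)"
    by (rule has_L2_fourier_some)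
  then have [measurable]: "L2_fourier ?f \<in> borel_measurable borel"
    unfolding has_L2_fourier_def by auto
  have i: "integrable lborel (\<lambda>\<xi>. (1 + \<xi>\<^sup>2) powr s * (cmod (?g \<xi>))\<^sup>2)"
  proof (rule Bochner_Integration.integrable_bound)
    show "integrable lborel (\<lambda>\<xi>. 2 * a\<^sup>2 * ((1 + \<xi>\<^sup>2) powr s * (cmod (L2_fourier f1 \<xi>))\<^sup>2) +
        2 * b\<^sup>2 * ((1 + \<xi>\<^sup>2) powr s * (cmod (L2_fourier f2 \<xi>))\<^sup>2))"
      using f1 f2 unfolding sobolev_space_def by (intro Bochner_Integration.integrable_add integrable_mult_right) auto
    have "(1 + \<xi>\<^sup>2) powr s * (cmod (?g \<xi>))\<^sup>2 \<le> 2 * a\<^sup>2 * ((1 + \<xi>\<^sup>2) powr s * (cmod (L2_fourier f1 \<xi>))\<^sup>2) +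
        2 * b\<^sup>2 * ((1 + \<xi>\<^sup>2) powr s * (cmod (L2_fourier f2 \<xi>))\<^sup>2)" for \<xi>
    proof -
      have "(1 + \<xi>\<^sup>2) powr s * (cmod (?g \<xi>))\<^sup>2 \<le> (1 + \<xi>\<^sup>2) powr s *
          (2 * (cmod (complex_of_real a * L2_fourier f1 \<xi>))\<^sup>2 + 2 * (cmod (complex_of_real b * L2_fourier f2 \<xi>))\<^sup>2)"
        by (intro mult_left_mono norm_sum_squared_le) auto
      then show ?thesis
        by (simp add: norm_mult power_mult_distrib algebra_simps)
    qed
    then show "AE \<xi> in lborel. norm ((1 + \<xi>\<^sup>2) powr s * (cmod (?g \<xi>))\<^sup>2) \<le>
        norm (2 * a\<^sup>2 * ((1 + \<xi>\<^sup>2) powr s * (cmod (L2_fourier f1 \<xi>))\<^sup>2) +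
        2 * b\<^sup>2 * ((1 + \<xi>\<^sup>2) powr s * (cmod (L2_fourier f2 \<xi>))\<^sup>2))"
      by (intro AE_I2) (simp add: order_trans[OF _ abs_ge_self])
  qed measurable
  have "integrable lborel (\<lambda>\<xi>. (1 + \<xi>\<^sup>2) powr s * (cmod (L2_fourier ?f \<xi>))\<^sup>2)"
    by (rule integrable_cong_AE_imp[OF i]) (use has_L2_fourier_unique[OF L fg] in \<open>measurable, auto\<close>)
  moreover have "continuous_on UNIV ?f"
    using f1 f2 unfolding sobolev_space_def by (auto intro!: continuous_intros)
  ultimately show ?thesis
    unfolding sobolev_space_def using fg by blast
qed

text \<open>Cauchy-Schwarz after splitting the weight as (1 + \<xi>^2)^(-(s-r)/2) times (1 +
  \<xi>^2)^(s/2); the first factor is square integrable because s - r > 1/2. The case r = 0 controls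
  a function, r = 1 its derivative.\<close>

lemma sobolev_weighted_L1:
  fixes r s :: real
  assumes f: "f \<in> sobolev_space s" and s: "s > r + 1 / 2"
  shows "integrable lborel (\<lambda>\<xi>. (1 + \<xi>\<^sup>2) powr (r / 2) * cmod (L2_fourier f \<xi>))"
    and "(LINT \<xi>|lborel. (1 + \<xi>\<^sup>2) powr (r / 2) * cmod (L2_fourier f \<xi>))
      \<le> sqrt (LINT \<xi>|lborel. (1 + \<xi>\<^sup>2) powr (- (s - r))) * sobolev_norm s f"
proof -
  have [measurable]: "L2_fourier f \<in> borel_measurable borel"
    using f borel_measurable_L2_fourier by auto
  let ?a = "\<lambda>\<xi>::real. (1 + \<xi>\<^sup>2) powr (- (s - r) / 2)"
  let ?b = "\<lambda>\<xi>::real. (1 + \<xi>\<^sup>2) powr (s / 2) * cmod (L2_fourier f \<xi>)"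
  have sq: "(y powr (c / 2))\<^sup>2 = y powr c" for y c :: real
    by (simp add: power2_eq_square flip: powr_add)
  have a: "(\<lambda>\<xi>. (?a \<xi>)\<^sup>2) = (\<lambda>\<xi>. (1 + \<xi>\<^sup>2) powr (- (s - r)))"
    by (intro ext sq)
  have b: "(\<lambda>\<xi>. (?b \<xi>)\<^sup>2) = (\<lambda>\<xi>. (1 + \<xi>\<^sup>2) powr s * (cmod (L2_fourier f \<xi>))\<^sup>2)"
    by (simp add: power_mult_distrib sq)
  have ab: "?a \<xi> * ?b \<xi> = (1 + \<xi>\<^sup>2) powr (r / 2) * cmod (L2_fourier f \<xi>)" for \<xi>
  proof -
    have "?a \<xi> * (1 + \<xi>\<^sup>2) powr (s / 2) = (1 + \<xi>\<^sup>2) powr (r / 2)"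
      by (simp add: field_simps flip: powr_add)
    then show ?thesis
      by (simp add: mult.assoc[symmetric])
  qed
  have ia: "integrable lborel (\<lambda>\<xi>. (?a \<xi>)\<^sup>2)"
    unfolding a using s by (intro integrable_powr_weight) auto
  have ib: "integrable lborel (\<lambda>\<xi>. (?b \<xi>)\<^sup>2)"
    unfolding b using f unfolding sobolev_space_def by auto
  have ma: "?a \<in> borel_measurable lborel" and mb: "?b \<in> borel_measurable lborel"
    by measurable
  show "integrable lborel (\<lambda>\<xi>. (1 + \<xi>\<^sup>2) powr (r / 2) * cmod (L2_fourier f \<xi>))"
    using Cauchy_Schwarz_integral(1)[OF ma mb ia ib] by (simp only: ab)
  have abs_ab: "\<bar>?a \<xi> * ?b \<xi>\<bar> = (1 + \<xi>\<^sup>2) powr (r / 2) * cmod (L2_fourier f \<xi>)" for \<xi>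
    unfolding ab by simp
  show "(LINT \<xi>|lborel. (1 + \<xi>\<^sup>2) powr (r / 2) * cmod (L2_fourier f \<xi>))
      \<le> sqrt (LINT \<xi>|lborel. (1 + \<xi>\<^sup>2) powr (- (s - r))) * sobolev_norm s f"
    using Cauchy_Schwarz_integral(2)[OF ma mb ia ib] by (simp only: sobolev_norm_def abs_ab a b)
qed

lemma integrable_L2_fourier:
  assumes "f \<in> sobolev_space s" "s > 1 / 2"
  shows "integrable lborel (L2_fourier f)"
proof -
  \<comment> \<open>Needed to simplify the weight for r = 0: \<open>x powr 0\<close> is 1 only for
    nonzero \<open>x\<close>, and \<open>0 powr 0\<close> is 0.\<close>
  have "1 + \<xi>\<^sup>2 \<noteq> 0" for \<xi> :: real
    by (simp add: add_nonneg_eq_0_iff)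
  then have "integrable lborel (\<lambda>\<xi>. cmod (L2_fourier f \<xi>))"
    using sobolev_weighted_L1(1)[OF assms(1), of 0] assms(2) by simp
  then show ?thesis
    using borel_measurable_L2_fourier[OF assms(1)] by (simp add: integrable_norm_iff)
qed

lemma sobolev_inversion:
  assumes f: "f \<in> sobolev_space s" and s: "s > 1 / 2"
  shows "complex_of_real (f x) = (LINT \<xi>|lborel. L2_fourier f \<xi> * cis (x * \<xi>)) / complex_of_real (2 * pi)"
  using f s by (intro L2_fourier_inversion has_L2_fourier_L2_fourier integrable_L2_fourier)
    (auto simp: sobolev_space_def)

lemma sobolev_sup_bound:
  assumes "s > 1 / 2"
  shows "\<exists>C. \<forall>f\<in>sobolev_space s. \<forall>x. \<bar>f x\<bar> \<le> C * sobolev_norm s f"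
proof (intro exI ballI allI)
  \<comment> \<open>Written with \<open>s - 0\<close> to match \<open>sobolev_weighted_L1\<close> at
    r = 0; the 2 pi is that of the inversion formula.\<close>
  let ?C = "sqrt (LINT \<xi>|lborel. (1 + \<xi>\<^sup>2) powr (- (s - 0))) / (2 * pi)"
  show "\<bar>f x\<bar> \<le> ?C * sobolev_norm s f" if f: "f \<in> sobolev_space s" for f x
  proof -
    have nz: "1 + \<xi>\<^sup>2 \<noteq> 0" for \<xi> :: real
      by (simp add: add_nonneg_eq_0_iff)
    have "\<bar>f x\<bar> = cmod (complex_of_real (f x))"
      by simp
    also have "\<dots> = cmod (LINT \<xi>|lborel. L2_fourier f \<xi> * cis (x * \<xi>)) / (2 * pi)"
      unfolding sobolev_inversion[OF f assms] by (simp add: norm_divide norm_mult)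
    also have "\<dots> \<le> (LINT \<xi>|lborel. cmod (L2_fourier f \<xi> * cis (x * \<xi>))) / (2 * pi)"
      by (intro divide_right_mono integral_norm_bound) auto
    also have "\<dots> \<le> sqrt (LINT \<xi>|lborel. (1 + \<xi>\<^sup>2) powr (- (s - 0))) * sobolev_norm s f / (2 * pi)"
      using sobolev_weighted_L1(2)[OF f, of 0] assms nz
      by (intro divide_right_mono) (auto simp: norm_mult)
    finally show ?thesis
      by simp
  qed
qed

text \<open>For s > 3/2 the function \<xi> g, with g the transform, is still integrable, so the
  inversion formula may be differentiated under the integral. The real part serves only to obtain a
  real-valued candidate \<open>f'\<close>.\<close>

lemma sobolev_C1:
  assumes s: "s > 3 / 2" and f: "f \<in> sobolev_space s"
  defines "f' \<equiv> \<lambda>x. Re ((LINT \<xi>|lborel. \<i> * complex_of_real \<xi> * L2_fourier f \<xi> * cis (x * \<xi>)) / complex_of_real (2 * pi))"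
  shows "(f has_real_derivative f' x) (at x)" and "isCont f' x"
    and "\<bar>f' x\<bar> \<le> sqrt (LINT \<xi>|lborel. (1 + \<xi>\<^sup>2) powr (- (s - 1))) / (2 * pi) * sobolev_norm s f"
proof -
  let ?g = "L2_fourier f"
  have [measurable]: "?g \<in> borel_measurable borel"
    using f borel_measurable_L2_fourier by auto
  have le: "\<bar>\<xi>\<bar> * cmod (?g \<xi>) \<le> (1 + \<xi>\<^sup>2) powr (1 / 2) * cmod (?g \<xi>)" for \<xi>
  proof (rule mult_right_mono)
    have "\<bar>\<xi>\<bar> = sqrt (\<xi>\<^sup>2)"
      by simp
    also have "\<dots> \<le> sqrt (1 + \<xi>\<^sup>2)"
      by (rule real_sqrt_le_mono) simp
    also have "\<dots> = (1 + \<xi>\<^sup>2) powr (1 / 2)"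
      by (simp add: powr_half_sqrt)
    finally show "\<bar>\<xi>\<bar> \<le> (1 + \<xi>\<^sup>2) powr (1 / 2)" .
  qed auto
  have w: "integrable lborel (\<lambda>\<xi>. (1 + \<xi>\<^sup>2) powr (1 / 2) * cmod (?g \<xi>))"
    using sobolev_weighted_L1(1)[OF f, of 1] s by simp
  have xg: "integrable lborel (\<lambda>\<xi>. \<i> * complex_of_real \<xi> * ?g \<xi>)"
    by (rule Bochner_Integration.integrable_bound[OF w])
      (measurable, rule AE_I2, simp add: norm_mult le)
  have g: "integrable lborel ?g"
    using f s by (intro integrable_L2_fourier) auto
  have "((\<lambda>h. Re (((LINT \<xi>|lborel. ?g \<xi> * cis ((x + h) * \<xi>)) - (LINT \<xi>|lborel. ?g \<xi> * cis (x * \<xi>))) / complex_of_real h / complex_of_real (2 * pi)))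
      \<longlongrightarrow> f' x) (at 0)"
    unfolding f'_def by (intro tendsto_Re tendsto_divide integral_cis_has_derivative[OF g xg] tendsto_const) auto
  moreover have "Re (((LINT \<xi>|lborel. ?g \<xi> * cis ((x + h) * \<xi>)) - (LINT \<xi>|lborel. ?g \<xi> * cis (x * \<xi>))) / complex_of_real h / complex_of_real (2 * pi)) =
      (f (x + h) - f x) / h" for h
  proof -
    have "((LINT \<xi>|lborel. ?g \<xi> * cis ((x + h) * \<xi>)) - (LINT \<xi>|lborel. ?g \<xi> * cis (x * \<xi>))) / complex_of_real h / complex_of_real (2 * pi) =
      (complex_of_real (f (x + h)) - complex_of_real (f x)) / complex_of_real h"
      using s by (subst (1 2) sobolev_inversion[OF f]) (auto simp: diff_divide_distrib mult_ac)
    also have "\<dots> = complex_of_real ((f (x + h) - f x) / h)"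
      by simp
    finally show ?thesis
      by (simp only: Re_complex_of_real)
  qed
  ultimately show "(f has_real_derivative f' x) (at x)"
    unfolding DERIV_def by simp
  show "isCont f' x"
    unfolding f'_def by (intro isCont_Re isCont_divide isCont_integral_cis xg continuous_const) auto
  have "\<bar>f' x\<bar> \<le> cmod ((LINT \<xi>|lborel. \<i> * complex_of_real \<xi> * ?g \<xi> * cis (x * \<xi>)) / complex_of_real (2 * pi))"
    unfolding f'_def by (rule abs_Re_le_cmod)
  also have "\<dots> = cmod (LINT \<xi>|lborel. \<i> * complex_of_real \<xi> * ?g \<xi> * cis (x * \<xi>)) / (2 * pi)"
    by (simp add: norm_divide norm_mult)
  also have "\<dots> \<le> (LINT \<xi>|lborel. (1 + \<xi>\<^sup>2) powr (1 / 2) * cmod (?g \<xi>)) / (2 * pi)"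
  proof (intro divide_right_mono Bochner_Integration.integral_norm_bound_integral w)
    show "integrable lborel (\<lambda>\<xi>. \<i> * complex_of_real \<xi> * ?g \<xi> * cis (x * \<xi>))"
      by (rule Bochner_Integration.integrable_bound[OF xg]) (auto simp: norm_mult)
    show "cmod (\<i> * complex_of_real \<xi> * ?g \<xi> * cis (x * \<xi>)) \<le> (1 + \<xi>\<^sup>2) powr (1 / 2) * cmod (?g \<xi>)" for \<xi>
      using le[of \<xi>] by (simp add: norm_mult)
  qed simp
  also have "\<dots> \<le> sqrt (LINT \<xi>|lborel. (1 + \<xi>\<^sup>2) powr (- (s - 1))) * sobolev_norm s f / (2 * pi)"
    using sobolev_weighted_L1(2)[OF f, of 1] s by (intro divide_right_mono) auto
  finally show "\<bar>f' x\<bar> \<le> sqrt (LINT \<xi>|lborel. (1 + \<xi>\<^sup>2) powr (- (s - 1))) / (2 * pi) * sobolev_norm s f"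
    by simp
qed

lemma sobolev_deriv:
  assumes "s > 3 / 2" "f \<in> sobolev_space s"
  shows "(f has_real_derivative deriv f x) (at x)" "isCont (deriv f) x"
proof -
  obtain f' where f': "\<And>x. (f has_real_derivative f' x) (at x)" "\<And>x. isCont f' x"
    by (rule that[OF sobolev_C1(1)[OF assms] sobolev_C1(2)[OF assms]])
  then have "deriv f = f'"
    by (auto intro: DERIV_imp_deriv)
  then show "(f has_real_derivative deriv f x) (at x)" "isCont (deriv f) x"
    using f' by auto
qed

lemma sobolev_deriv_sup_bound:
  assumes s: "s > 3 / 2"
  shows "\<exists>C. \<forall>f\<in>sobolev_space s. \<forall>x. \<bar>deriv f x\<bar> \<le> C * sobolev_norm s f"
proof (intro exI ballI allI)
  let ?C = "sqrt (LINT \<xi>|lborel. (1 + \<xi>\<^sup>2) powr (- (s - 1))) / (2 * pi)"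
  show "\<bar>deriv f x\<bar> \<le> ?C * sobolev_norm s f" if f: "f \<in> sobolev_space s" for f x
    by (subst DERIV_imp_deriv[OF sobolev_C1(1)[OF s f]]) (rule sobolev_C1(3)[OF s f])
qed

section \<open>One-sided exponential averages\<close>

text \<open>The part of 2 p * F contributed by the points to the left of \<open>x\<close>. In terms
  of the distance z both halves are averages against the exponential probability density, so sup
  bounds pass through with constant 1.\<close>

definition laplace_left :: "(real \<Rightarrow> real) \<Rightarrow> real \<Rightarrow> real" where
  "laplace_left F x = (LINT z|lborel. indicator {0..} z * exp (- z) * F (x - z))"

definition laplace_right :: "(real \<Rightarrow> real) \<Rightarrow> real \<Rightarrow> real" where
  "laplace_right F x = (LINT z|lborel. indicator {0..} z * exp (- z) * F (x + z))"

lemma laplace_right_reflect: "laplace_right F x = laplace_left (\<lambda>y. F (- y)) (- x)"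
  by (simp add: laplace_right_def laplace_left_def add.commute)

lemma has_bochner_integral_exp_decay:
  "has_bochner_integral lborel (\<lambda>z::real. indicator {0..} z * exp (- z)) 1"
proof (rule has_bochner_integral_nn_integral)
  have "(\<integral>\<^sup>+z. ennreal (exp (- z)) * indicator {0::real..} z \<partial>lborel) = ennreal (0 - (- exp (- 0)))"
  proof (rule nn_integral_FTC_atLeast)
    show "((\<lambda>z::real. - exp (- z)) \<longlongrightarrow> 0) at_top"
      using tendsto_minus[OF filterlim_compose[OF exp_at_bot filterlim_uminus_at_bot_at_top]] by simp
  qed (auto intro!: derivative_eq_intros)
  then show "(\<integral>\<^sup>+z. ennreal (indicator {0::real..} z * exp (- z)) \<partial>lborel) = ennreal 1"
    by (simp add: ennreal_mult' ennreal_indicator mult.commute)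
qed auto

lemma integrable_exp_decay_mult:
  fixes F :: "real \<Rightarrow> real"
  assumes [measurable]: "F \<in> borel_measurable borel" and "\<And>x. \<bar>F x\<bar> \<le> M"
  shows "integrable lborel (\<lambda>z. indicator {0..} z * exp (- z) * F z)"
proof (rule Bochner_Integration.integrable_bound)
  show "integrable lborel (\<lambda>z. indicator {0..} z * exp (- z) * M)"
    using has_bochner_integral_exp_decay by (intro integrable_mult_left) (auto simp: has_bochner_integral_iff)
  show "AE z in lborel. norm (indicator {0..} z * exp (- z) * F z) \<le> norm (indicator {0..} z * exp (- z) * M)"
    using order_trans[OF assms(2) abs_ge_self] by (auto simp: abs_mult intro!: mult_left_mono)
qed measurable

lemma abs_integral_exp_decay_le:
  fixes F :: "real \<Rightarrow> real"
  assumes "F \<in> borel_measurable borel" "\<And>x. \<bar>F x\<bar> \<le> M"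
  shows "\<bar>LINT z|lborel. indicator {0..} z * exp (- z) * F z\<bar> \<le> M"
proof -
  have "norm (LINT z|lborel. indicator {0..} z * exp (- z) * F z) \<le> (LINT z|lborel. indicator {0..} z * exp (- z) * M)"
  proof (rule Bochner_Integration.integral_norm_bound_integral)
    show "integrable lborel (\<lambda>z. indicator {0..} z * exp (- z) * M)"
      using has_bochner_integral_exp_decay by (intro integrable_mult_left) (auto simp: has_bochner_integral_iff)
    show "norm (indicator {0..} z * exp (- z) * F z) \<le> indicator {0..} z * exp (- z) * M" for z
      using assms(2) by (auto simp: abs_mult intro!: mult_left_mono)
  qed (rule integrable_exp_decay_mult[OF assms])
  also have "\<dots> = M"
    using has_bochner_integral_exp_decay by (simp add: has_bochner_integral_iff)
  finally show ?thesis
    by simp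
qed

lemma
  assumes F: "continuous_on UNIV F" and M: "\<And>x. \<bar>F x\<bar> \<le> M"
  shows abs_laplace_left_le: "\<bar>laplace_left F x\<bar> \<le> M"
    and abs_laplace_right_le: "\<bar>laplace_right F x\<bar> \<le> M"
proof -
  have [measurable]: "F \<in> borel_measurable borel"
    using F by (rule borel_measurable_continuous_onI)
  show "\<bar>laplace_left F x\<bar> \<le> M" "\<bar>laplace_right F x\<bar> \<le> M"
    unfolding laplace_left_def laplace_right_def
    by (rule abs_integral_exp_decay_le; use M in simp)+
qed

text \<open>Averaging against a density of mass 1 does not increase sup distances; the bounds
  \<open>M\<close> and \<open>N\<close> make the two integrals exist separately.\<close>

lemma
  assumes F: "continuous_on UNIV F" "\<And>x. \<bar>F x\<bar> \<le> M"
    and G: "continuous_on UNIV G" "\<And>x. \<bar>G x\<bar> \<le> N" and d: "\<And>x. \<bar>F x - G x\<bar> \<le> e"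
  shows laplace_left_diff_le: "\<bar>laplace_left F x - laplace_left G x\<bar> \<le> e"
    and laplace_right_diff_le: "\<bar>laplace_right F x - laplace_right G x\<bar> \<le> e"
proof -
  have *: "\<bar>(LINT z|lborel. indicator {0..} z * exp (- z) * F (\<phi> z)) - (LINT z|lborel. indicator {0..} z * exp (- z) * G (\<phi> z))\<bar> \<le> e"
    if "continuous_on UNIV \<phi>" for \<phi> :: "real \<Rightarrow> real"
  proof -
    have [measurable]: "F \<in> borel_measurable borel" "G \<in> borel_measurable borel" "\<phi> \<in> borel_measurable borel"
      using F(1) G(1) that by (auto intro: borel_measurable_continuous_onI)
    have m: "(\<lambda>z. F (\<phi> z)) \<in> borel_measurable borel" "(\<lambda>z. G (\<phi> z)) \<in> borel_measurable borel"
      by measurable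
    have "(LINT z|lborel. indicator {0..} z * exp (- z) * F (\<phi> z)) - (LINT z|lborel. indicator {0..} z * exp (- z) * G (\<phi> z)) =
        (LINT z|lborel. indicator {0..} z * exp (- z) * (F (\<phi> z) - G (\<phi> z)))"
      using integrable_exp_decay_mult[OF m(1) F(2)] integrable_exp_decay_mult[OF m(2) G(2)]
      by (simp add: right_diff_distrib)
    then show ?thesis
      using abs_integral_exp_decay_le[of "\<lambda>z. F (\<phi> z) - G (\<phi> z)" e] m d by simp
  qed
  show "\<bar>laplace_left F x - laplace_left G x\<bar> \<le> e" "\<bar>laplace_right F x - laplace_right G x\<bar> \<le> e"
    unfolding laplace_left_def laplace_right_def by (intro * continuous_intros)+
qed

text \<open>Multiplication by \<open>exp x\<close> leaves \<open>x\<close> only in the endpoint of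
  integration, so the fundamental theorem of calculus gives the derivative for merely continuous
  \<open>F\<close>.\<close>

lemma laplace_left_alt:
  "exp x * laplace_left F x = (LINT y|lborel. indicator {..x} y * (exp y * F y))"
proof -
  have "(LINT y|lborel. indicator {..x} y * (exp y * F y)) = (LINT z|lborel. indicator {..x} (x - z) * (exp (x - z) * F (x - z)))"
    using lborel_integral_real_affine[of "-1" "\<lambda>y. indicator {..x} y * (exp y * F y)" x] by simp
  also have "\<dots> = (LINT z|lborel. exp x * (indicator {0..} z * exp (- z) * F (x - z)))"
    by (intro Bochner_Integration.integral_cong) (auto simp: indicator_def exp_diff exp_minus field_simps)
  also have "\<dots> = exp x * laplace_left F x"
    unfolding laplace_left_def by (rule integral_mult_right_zero)
  finally show ?thesis ..
qed

lemma has_derivative_laplace_left: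
  assumes F: "continuous_on UNIV F" and M: "\<And>x. \<bar>F x\<bar> \<le> M"
  shows "(laplace_left F has_real_derivative F x - laplace_left F x) (at x)"
proof -
  have [measurable]: "F \<in> borel_measurable borel"
    using F by (rule borel_measurable_continuous_onI)
  define J where "J = (\<lambda>x. LINT y|lborel. indicator {..x} y * (exp y * F y))"
  have int: "integrable lborel (\<lambda>y. indicator {..b} y * (exp y * F y))" for b
  proof -
    have "integrable lborel (\<lambda>z. indicator {0..} z * exp (- z) * F (b - z))"
      by (rule integrable_exp_decay_mult) (use M in auto)
    then have "integrable lborel (\<lambda>y. indicator {0..} (b - y) * exp (- (b - y)) * F (b - (b - y)))"
      using lborel_integrable_real_affine[of "\<lambda>z. indicator {0..} z * exp (- z) * F (b - z)" "-1" b] by simp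
    then have "integrable lborel (\<lambda>y. exp b * (indicator {0..} (b - y) * exp (- (b - y)) * F (b - (b - y))))"
      by (rule integrable_mult_right)
    moreover have "exp b * (indicator {0..} (b - y) * exp (- (b - y)) * F (b - (b - y))) = indicator {..b} y * (exp y * F y)" for y
      by (auto simp: indicator_def exp_diff)
    ultimately show ?thesis
      by (simp only:)
  qed
  have cont: "continuous_on S (\<lambda>y. exp y * F y)" for S
    by (intro continuous_intros continuous_on_subset[OF F]) auto
  \<comment> \<open>Splits off a tail that does not depend on \<open>b\<close>, leaving an integral
    over a compact interval to differentiate.\<close>
  have J: "J b = J a + integral {a..b} (\<lambda>y. exp y * F y)" if "a \<le> b" for a b
  proof -
    have s: "set_integrable lborel {a..b} (\<lambda>y. exp y * F y)"
      by (rule borel_integrable_atLeastAtMost') (rule cont)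
    have "J b = (LINT y|lborel. indicator {..a} y * (exp y * F y) + indicator {a..b} y *\<^sub>R (exp y * F y))"
      unfolding J_def
    proof (rule integral_cong_AE)
      \<comment> \<open>The indicators of \<open>{..a}\<close> and \<open>{a..b}\<close> overlap at
        \<open>a\<close>, so the identity holds only off that point.\<close>
      show "AE y in lborel. indicator {..b} y * (exp y * F y) =
          indicator {..a} y * (exp y * F y) + indicator {a..b} y *\<^sub>R (exp y * F y)"
        using AE_lborel_singleton[of a] by eventually_elim (use that in \<open>auto simp: indicator_def\<close>)
    qed measurable
    also have "\<dots> = J a + (LINT y:{a..b}|lborel. exp y * F y)"
      unfolding J_def set_lebesgue_integral_def
      by (intro Bochner_Integration.integral_add int s[unfolded set_integrable_def])
    also have "(LINT y:{a..b}|lborel. exp y * F y) = integral {a..b} (\<lambda>y. exp y * F y)"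
      by (rule set_borel_integral_eq_integral(2)[OF s])
    finally show ?thesis .
  qed
  have "((\<lambda>b. integral {x-1..b} (\<lambda>y. exp y * F y)) has_real_derivative exp x * F x) (at x within {x-1..x+1})"
    by (rule integral_has_real_derivative[OF cont]) auto
  then have "((\<lambda>b. J (x-1) + integral {x-1..b} (\<lambda>y. exp y * F y)) has_real_derivative 0 + exp x * F x) (at x within {x-1..x+1})"
    by (intro DERIV_add DERIV_const)
  moreover have "at x within {x-1..x+1} = at x"
    by (rule at_within_interior) simp
  ultimately have "((\<lambda>b. J (x-1) + integral {x-1..b} (\<lambda>y. exp y * F y)) has_real_derivative exp x * F x) (at x)"
    by (simp only: add_0)
  then have "(J has_real_derivative exp x * F x) (at x)"
    by (rule has_field_derivative_transform_within_open[of _ _ _ "{x-1<..}"]) (simp_all add: J[symmetric])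
  then have "((\<lambda>x. exp (- x) * J x) has_real_derivative - exp (- x) * J x + exp (- x) * (exp x * F x)) (at x)"
    by (auto intro!: derivative_eq_intros)
  moreover have "(\<lambda>x. exp (- x) * J x) = laplace_left F"
    unfolding J_def laplace_left_alt[symmetric] by (simp add: exp_minus fun_eq_iff)
  moreover have "- exp (- x) * J x + exp (- x) * (exp x * F x) = F x - laplace_left F x"
    unfolding J_def laplace_left_alt[symmetric] by (simp add: exp_minus flip: mult.assoc)
  ultimately show ?thesis
    by simp
qed

lemma has_derivative_laplace_right:
  assumes F: "continuous_on UNIV F" and M: "\<And>x. \<bar>F x\<bar> \<le> M"
  shows "(laplace_right F has_real_derivative laplace_right F x - F x) (at x)"
proof -
  have "continuous_on UNIV (\<lambda>y. F (- y))"
    by (intro continuous_on_compose2[OF F] continuous_intros) auto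
  then have "(laplace_left (\<lambda>y. F (- y)) has_real_derivative F (- (- x)) - laplace_left (\<lambda>y. F (- y)) (- x)) (at (- x))"
    using M by (rule has_derivative_laplace_left)
  from DERIV_chain2[OF this DERIV_minus[OF DERIV_ident]]
  show ?thesis
    unfolding laplace_right_reflect[abs_def] by simp
qed

lemma convolve_CH_kernel:
  assumes F: "continuous_on UNIV F" and M: "\<And>x. \<bar>F x\<bar> \<le> M"
  shows "convolve CH_kernel F x = (laplace_left F x + laplace_right F x) / 2"
proof -
  have [measurable]: "F \<in> borel_measurable borel"
    using F by (rule borel_measurable_continuous_onI)
  have l: "integrable lborel (\<lambda>z. indicator {0..} z * exp (- z) * F (x - z))"
    by (rule integrable_exp_decay_mult) (use M in auto)
  have r: "integrable lborel (\<lambda>z. indicator {0..} z * exp (- z) * F (x + z))"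
    by (rule integrable_exp_decay_mult) (use M in auto)
  have r': "integrable lborel (\<lambda>z. indicator {0..} (- z) * exp z * F (x - z))"
    using lborel_integrable_real_affine[OF r, of "-1" 0] by simp
  have r'_eq: "laplace_right F x = (LINT z|lborel. indicator {0..} (- z) * exp z * F (x - z))"
    unfolding laplace_right_def
    using lborel_integral_real_affine[of "-1" "\<lambda>z. indicator {0..} z * exp (- z) * F (x + z)" 0] by simp
  have "convolve CH_kernel F x = (LINT z|lborel. exp (- \<bar>z\<bar>) / 2 * F (x - z))"
    unfolding convolve_def CH_kernel_def
    using lborel_integral_real_affine[of "-1" "\<lambda>y. exp (- \<bar>x - y\<bar>) / 2 * F y" x] by simp
  also have "\<dots> = (LINT z|lborel. (indicator {0..} z * exp (- z) * F (x - z) + indicator {0..} (- z) * exp z * F (x - z)) / 2)"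
  proof (rule integral_cong_AE)
    show "AE z in lborel. exp (- \<bar>z\<bar>) / 2 * F (x - z) =
        (indicator {0..} z * exp (- z) * F (x - z) + indicator {0..} (- z) * exp z * F (x - z)) / 2"
      using AE_lborel_singleton[of 0] by eventually_elim (auto simp: indicator_def)
  qed measurable
  also have "\<dots> = (laplace_left F x + laplace_right F x) / 2"
    unfolding r'_eq unfolding laplace_left_def
    by (simp only: integral_divide_zero Bochner_Integration.integral_add[OF l r'])
  finally show ?thesis .
qed

text \<open>The contributions of \<open>F x\<close> to the two one-sided derivatives cancel. What
  remains is differentiable again, so a second derivative of the convolution costs no derivative of
  \<open>F\<close>.\<close>

lemma deriv_convolve_CH_kernel:
  assumes F: "continuous_on UNIV F" and M: "\<And>x. \<bar>F x\<bar> \<le> M"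
  shows "deriv (convolve CH_kernel F) x = (laplace_right F x - laplace_left F x) / 2"
proof (rule DERIV_imp_deriv)
  have "((\<lambda>x. (laplace_left F x + laplace_right F x) / 2) has_real_derivative
      ((F x - laplace_left F x) + (laplace_right F x - F x)) / 2) (at x)"
    by (intro DERIV_cdivide DERIV_add has_derivative_laplace_left[OF F M] has_derivative_laplace_right[OF F M])
  then show "(convolve CH_kernel F has_real_derivative (laplace_right F x - laplace_left F x) / 2) (at x)"
    unfolding convolve_CH_kernel[OF F M, abs_def] by simp
qed

text \<open>
  With \<open>W = laplace_left (f\<^sup>2 + f'\<^sup>2/2) - f\<^sup>2/2\<close> one has \<open>W' + W = (f - f')\<^sup>2/2 \<ge> 0\<close>, so \<open>exp x * W x\<close>
  increases from its limit 0 at \<open>-\<infinity>\<close>.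
\<close>

lemma laplace_left_ge:
  assumes f: "\<And>x. (f has_real_derivative f' x) (at x)" and f': "continuous_on UNIV f'"
    and M: "\<And>x. \<bar>f x\<bar> \<le> M" "\<And>x. \<bar>f' x\<bar> \<le> M"
  shows "(f x)\<^sup>2 / 2 \<le> laplace_left (\<lambda>y. (f y)\<^sup>2 + (f' y)\<^sup>2 / 2) x"
proof -
  let ?F = "\<lambda>y. (f y)\<^sup>2 + (f' y)\<^sup>2 / 2"
  let ?E = "\<lambda>y. exp y * (laplace_left ?F y - (f y)\<^sup>2 / 2)"
  have cf: "continuous_on UNIV f"
    using f by (meson DERIV_isCont continuous_at_imp_continuous_on)
  have cF: "continuous_on UNIV ?F"
    by (auto intro!: continuous_intros cf f')
  have sq: "(f y)\<^sup>2 \<le> M\<^sup>2" "(f' y)\<^sup>2 \<le> M\<^sup>2" for y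
    using M[of y] by (auto simp: abs_le_square_iff[symmetric] intro: order_trans[OF _ abs_ge_self])
  have bF: "\<bar>?F y\<bar> \<le> 2 * M\<^sup>2" for y
    using sq[of y] zero_le_power2[of M] zero_le_power2[of "f y"] zero_le_power2[of "f' y"] by linarith
  have D: "(?E has_real_derivative exp y * (f y - f' y)\<^sup>2 / 2) (at y)" for y
  proof -
    have "(?E has_real_derivative exp y * (laplace_left ?F y - (f y)\<^sup>2 / 2) +
        exp y * (?F y - laplace_left ?F y - f y * f' y)) (at y)"
      by (auto intro!: derivative_eq_intros has_derivative_laplace_left[OF cF bF] f)
    moreover have "exp y * (laplace_left ?F y - (f y)\<^sup>2 / 2) + exp y * (?F y - laplace_left ?F y - f y * f' y) =
        exp y * (f y - f' y)\<^sup>2 / 2"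
      by (simp add: power2_diff field_simps)
    ultimately show ?thesis
      by simp
  qed
  have "?E y \<le> ?E x" if "y \<le> x" for y
    by (rule DERIV_nonneg_imp_nondecreasing[OF that]) (use D in \<open>auto intro!: exI\<close>)
  \<comment> \<open>2 M^2 bounds the average and M^2 generously covers
    \<open>(f y)\<^sup>2 / 2\<close>. A crude constant suffices, as \<open>exp y\<close> tends to 0
    at minus infinity.\<close>
  moreover have "- (3 * M\<^sup>2) * exp y \<le> ?E y" for y
  proof -
    have "- (3 * M\<^sup>2) \<le> laplace_left ?F y - (f y)\<^sup>2 / 2"
      using abs_laplace_left_le[OF cF bF, of y] sq(1)[of y] zero_le_power2[of M] by linarith
    then show ?thesis
      using mult_left_mono[of _ _ "exp y"] by (simp only: mult.commute[of _ "exp y"] exp_ge_zero)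
  qed
  ultimately have "\<forall>\<^sub>F y in at_bot. - (3 * M\<^sup>2) * exp y \<le> ?E x"
    unfolding eventually_at_bot_linorder by (meson order_trans)
  moreover have "((\<lambda>y. - (3 * M\<^sup>2) * exp y) \<longlongrightarrow> - (3 * M\<^sup>2) * 0) at_bot"
    by (intro tendsto_mult tendsto_const exp_at_bot)
  ultimately have "- (3 * M\<^sup>2) * 0 \<le> ?E x"
    by (intro tendsto_upperbound) auto
  then show ?thesis
    by (simp add: zero_le_mult_iff)
qed

lemma laplace_right_ge:
  assumes f: "\<And>x. (f has_real_derivative f' x) (at x)" and f': "continuous_on UNIV f'"
    and M: "\<And>x. \<bar>f x\<bar> \<le> M" "\<And>x. \<bar>f' x\<bar> \<le> M"
  shows "(f x)\<^sup>2 / 2 \<le> laplace_right (\<lambda>y. (f y)\<^sup>2 + (f' y)\<^sup>2 / 2) x"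
proof -
  have "((\<lambda>y. f (- y)) has_real_derivative - f' (- y)) (at y)" for y
    using DERIV_chain2[OF f DERIV_minus[OF DERIV_ident], of y] by simp
  moreover have "continuous_on UNIV (\<lambda>y. - f' (- y))"
    by (intro continuous_intros continuous_on_compose2[OF f']) auto
  ultimately have "(f (- (- x)))\<^sup>2 / 2 \<le> laplace_left (\<lambda>y. (f (- y))\<^sup>2 + (- f' (- y))\<^sup>2 / 2) (- x)"
    by (rule laplace_left_ge) (use M in auto)
  then show ?thesis
    unfolding laplace_right_reflect[of _ x] by simp
qed

section \<open>Ordinary differential equations and uniform limits\<close>

lemma has_derivative_within_mono:
  fixes f :: "real \<Rightarrow> real"
  assumes "\<And>t. t \<in> {0..T} \<Longrightarrow> (f has_real_derivative f' t) (at t within {0..T})"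
    and "\<And>t. t \<in> {0..T} \<Longrightarrow> 0 \<le> f' t" and "0 \<le> a" "a \<le> b" "b \<le> T"
  shows "f a \<le> f b"
proof (rule DERIV_nonneg_imp_increasing_open[OF \<open>a \<le> b\<close>])
  show "\<exists>y. DERIV f x :> y \<and> 0 \<le> y" if "a < x" "x < b" for x
  proof (intro exI conjI)
    show "0 \<le> f' x"
      using assms that by auto
    have "at x within {0..T} = at x"
      using assms that by (intro at_within_interior) auto
    then show "DERIV f x :> f' x"
      using assms(1)[of x] assms that by simp
  qed
  have "continuous_on {0..T} f"
    using assms(1) by (meson DERIV_continuous continuous_on_eq_continuous_within)
  then show "continuous_on {a..b} f"
    using assms by (auto intro: continuous_on_subset)
qed

text \<open>The weight gains a factor 1 / K. It is used with D = M to see that the Picard operator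
  has bounded values, and with D = L times a distance to see that it contracts.\<close>

lemma exp_weighted_integral_le:
  fixes K :: real
  assumes "K > 0" "0 \<le> \<tau>" and h: "continuous_on {0..\<tau>} h" "\<And>s. s \<in> {0..\<tau>} \<Longrightarrow> \<bar>h s\<bar> \<le> D * exp (K * s)"
    and "D \<ge> 0"
  shows "exp (- K * \<tau>) * \<bar>integral {0..\<tau>} h\<bar> \<le> D / K"
proof -
  have i: "((\<lambda>s. D * exp (K * s)) has_integral D * exp (K * \<tau>) / K - D * exp (K * 0) / K) {0..\<tau>}"
    using assms by (intro fundamental_theorem_of_calculus)
      (auto intro!: derivative_eq_intros simp flip: has_real_derivative_iff_has_vector_derivative)
  have "\<bar>integral {0..\<tau>} h\<bar> \<le> integral {0..\<tau>} (\<lambda>s. D * exp (K * s))"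
    using integral_norm_bound_integral[of h "{0..\<tau>}" "\<lambda>s. D * exp (K * s)"] i h
    by (auto intro: integrable_continuous_interval has_integral_integrable)
  also have "\<dots> = D * exp (K * \<tau>) / K - D / K"
    using integral_unique[OF i] by simp
  finally have "exp (- K * \<tau>) * \<bar>integral {0..\<tau>} h\<bar> \<le> exp (- K * \<tau>) * (D * exp (K * \<tau>) / K - D / K)"
    by (intro mult_left_mono) auto
  also have "\<dots> = D / K - exp (- K * \<tau>) * (D / K)"
    by (simp add: right_diff_distrib exp_minus)
  also have "\<dots> \<le> D / K"
    using assms by simp
  finally show ?thesis .
qed

text \<open>Banach's fixed point theorem for \<open>w t = exp (-K t) (q t - x0)\<close> in the sup norm; the weight
  makes the Picard operator a contraction on the whole of \<open>[0, T]\<close>.\<close>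

lemma ode_solution_exists:
  fixes v :: "real \<Rightarrow> real \<Rightarrow> real"
  assumes T: "0 \<le> T"
    and cont: "\<And>w. continuous_on {0..T} w \<Longrightarrow> continuous_on {0..T} (\<lambda>t. v t (w t))"
    and lip: "\<And>t x y. t \<in> {0..T} \<Longrightarrow> \<bar>v t x - v t y\<bar> \<le> L * \<bar>x - y\<bar>"
    and bdd: "\<And>t x. t \<in> {0..T} \<Longrightarrow> \<bar>v t x\<bar> \<le> M"
  obtains q where "q 0 = x0"
    "\<And>t. t \<in> {0..T} \<Longrightarrow> (q has_real_derivative v t (q t)) (at t within {0..T})"
proof -
  have L: "0 \<le> L"
    using lip[of 0 1 0] T by auto
  have M: "0 \<le> M"
    using bdd[of 0 0] T by auto
  \<comment> \<open>Any K > L makes L / K < 1; adding 1 also keeps K positive when L = 0.\<close>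
  define K where "K = L + 1"
  have K: "K > 0" "L < K"
    using L by (auto simp: K_def)
  \<comment> \<open>Clamping time to \<open>{0..T}\<close> extends functions to the whole line, so
    that the complete space of bounded continuous functions on \<open>real\<close> can be
    used.\<close>
  define c where "c = (\<lambda>t. max 0 (min T t))"
  have c: "c t \<in> {0..T}" "continuous_on UNIV c" for t
    using T unfolding c_def by (auto intro!: continuous_intros)
  \<comment> \<open>The velocity along the path q = x0 + exp (K s) w, that is, with the weight
    undone.\<close>
  define G where "G = (\<lambda>(w :: real \<Rightarrow>\<^sub>C real) s. v s (x0 + exp (K * s) * apply_bcontfun w s))"
  have G: "continuous_on {0..T} (G w)" for w
    unfolding G_def by (intro cont continuous_intros continuous_on_apply_bcontfun)
  have Gi: "G w integrable_on {0..\<tau>}" and Gc: "continuous_on {0..\<tau>} (G w)" if "\<tau> \<in> {0..T}" for w \<tau>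
    using that continuous_on_subset[OF G, of "{0..\<tau>}" w] by (auto intro: integrable_continuous_interval)
  define P where "P = (\<lambda>w t. exp (- K * c t) * integral {0..c t} (G w))"
  have Pb: "P w \<in> bcontfun" for w
  proof (rule bcontfun_normI)
    have "continuous_on {0..T} (\<lambda>t. integral {0..t} (G w))"
      using T by (intro indefinite_integral_continuous_1 Gi) auto
    then have "continuous_on UNIV (\<lambda>t. integral {0..c t} (G w))"
      by (rule continuous_on_compose2) (use c in auto)
    then show "continuous_on UNIV (P w)"
      unfolding P_def using c(2) by (intro continuous_intros)
    show "norm (P w t) \<le> M / K" for t
    proof -
      have "\<bar>G w s\<bar> \<le> M * exp (K * s)" if "s \<in> {0..c t}" for s
      proof -
        have "\<bar>G w s\<bar> \<le> M * 1"
          using bdd that c(1)[of t] unfolding G_def by auto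
        also have "\<dots> \<le> M * exp (K * s)"
          using that K M by (intro mult_left_mono) auto
        finally show ?thesis .
      qed
      then show ?thesis
        unfolding P_def using exp_weighted_integral_le[OF K(1) _ Gc[OF c(1)] _ M, of t w] c(1)[of t]
        by (simp add: abs_mult)
    qed
  qed
  define \<Phi> where "\<Phi> = (\<lambda>w. Bcontfun (P w))"
  have \<Phi>: "apply_bcontfun (\<Phi> w) = P w" for w
    unfolding \<Phi>_def by (rule Bcontfun_inverse[OF Pb])
  have "\<forall>w w'. dist (\<Phi> w) (\<Phi> w') \<le> L / K * dist w w'"
  proof (intro allI dist_bound)
    fix w w' t
    let ?h = "\<lambda>s. G w s - G w' s"
    have "\<bar>?h s\<bar> \<le> L * dist w w' * exp (K * s)" if "s \<in> {0..c t}" for s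
    proof -
      have "\<bar>?h s\<bar> \<le> L * \<bar>exp (K * s) * apply_bcontfun w s - exp (K * s) * apply_bcontfun w' s\<bar>"
        using lip[of s "x0 + exp (K * s) * apply_bcontfun w s" "x0 + exp (K * s) * apply_bcontfun w' s"] that c(1)[of t]
        unfolding G_def by auto
      also have "\<dots> = L * (exp (K * s) * dist (apply_bcontfun w s) (apply_bcontfun w' s))"
        by (simp add: dist_real_def abs_mult flip: right_diff_distrib)
      also have "\<dots> \<le> L * (exp (K * s) * dist w w')"
        using L by (intro mult_left_mono dist_bounded) auto
      finally show ?thesis
        by (simp add: mult_ac)
    qed
    moreover have "continuous_on {0..c t} ?h"
      by (intro continuous_intros Gc c)
    ultimately have "exp (- K * c t) * \<bar>integral {0..c t} ?h\<bar> \<le> L * dist w w' / K"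
      using c(1)[of t] L by (intro exp_weighted_integral_le K) auto
    moreover have "integral {0..c t} ?h = integral {0..c t} (G w) - integral {0..c t} (G w')"
      by (intro Henstock_Kurzweil_Integration.integral_diff Gi c)
    ultimately show "dist (apply_bcontfun (\<Phi> w) t) (apply_bcontfun (\<Phi> w') t) \<le> L / K * dist w w'"
      unfolding \<Phi> P_def by (simp add: dist_real_def abs_mult flip: right_diff_distrib)
  qed
  then obtain w where w: "\<Phi> w = w"
    using banach_fix_type[of "L / K" \<Phi>] K L by auto
  define q where "q = (\<lambda>t. x0 + integral {0..t} (G w))"
  have q: "q t = x0 + exp (K * t) * apply_bcontfun w t" if "t \<in> {0..T}" for t
  proof -
    have "apply_bcontfun w t = exp (- K * t) * integral {0..t} (G w)"
      using \<Phi>[of w] that unfolding w P_def c_def by (simp add: fun_eq_iff)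
    then show ?thesis
      unfolding q_def by (simp add: exp_minus)
  qed
  show ?thesis
  proof (rule that)
    show "q 0 = x0"
      by (simp add: q_def)
    show "(q has_real_derivative v t (q t)) (at t within {0..T})" if t: "t \<in> {0..T}" for t
    proof -
      have "(q has_real_derivative 0 + G w t) (at t within {0..T})"
        unfolding q_def by (intro DERIV_add DERIV_const integral_has_real_derivative[OF G] t)
      then show ?thesis
        unfolding G_def using q[OF t] by simp
    qed
  qed
qed

text \<open>
  \<open>1/a + 1/b\<close> stays positive but decreases at rate at least \<open>(a/b + b/a)/2 \<ge> 1\<close>.
\<close>

lemma Riccati_pair_blowup:
  fixes a b :: "real \<Rightarrow> real"
  assumes T: "0 \<le> T"
    and a: "\<And>t. t \<in> {0..T} \<Longrightarrow> (a has_real_derivative a' t) (at t within {0..T})"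
    and b: "\<And>t. t \<in> {0..T} \<Longrightarrow> (b has_real_derivative b' t) (at t within {0..T})"
    and a': "\<And>t. t \<in> {0..T} \<Longrightarrow> a t * b t / 2 \<le> a' t"
    and b': "\<And>t. t \<in> {0..T} \<Longrightarrow> a t * b t / 2 \<le> b' t"
    and pos: "0 < a 0" "0 < b 0"
  shows "T < 1 / a 0 + 1 / b 0"
proof -
  have ca: "continuous_on {0..T} a" and cb: "continuous_on {0..T} b"
    using a b by (meson DERIV_continuous continuous_on_eq_continuous_within)+
  \<comment> \<open>Integrating factor: f' >= f g / 2 makes f exp (- \<integral> g / 2)
    nondecreasing, whatever the sign of g. Hence \<open>a\<close> and \<open>b\<close> are shown
    positive one at a time, each with the other as g.\<close>
  have positive: "0 < f t"
    if f: "\<And>t. t \<in> {0..T} \<Longrightarrow> (f has_real_derivative f' t) (at t within {0..T})"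
      and f': "\<And>t. t \<in> {0..T} \<Longrightarrow> f t * g t / 2 \<le> f' t"
      and g: "continuous_on {0..T} g" and f0: "0 < f 0" and t: "t \<in> {0..T}" for f f' g :: "real \<Rightarrow> real" and t
  proof -
    define I where "I = (\<lambda>t. integral {0..t} (\<lambda>s. g s / 2))"
    have I: "(I has_real_derivative g t / 2) (at t within {0..T})" if "t \<in> {0..T}" for t
      unfolding I_def by (intro integral_has_real_derivative that continuous_intros g) auto
    have "f 0 * exp (- I 0) \<le> f t * exp (- I t)"
    proof (rule has_derivative_within_mono[where f = "\<lambda>t. f t * exp (- I t)"])
      show "((\<lambda>t. f t * exp (- I t)) has_real_derivative (f' t - f t * g t / 2) * exp (- I t)) (at t within {0..T})"
        if "t \<in> {0..T}" for t
        using that by (auto intro!: derivative_eq_intros f I simp: algebra_simps)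
      show "0 \<le> (f' t - f t * g t / 2) * exp (- I t)" if "t \<in> {0..T}" for t
        using f'[OF that] by simp
    qed (use t in auto)
    moreover have "0 < f 0 * exp (- I 0)"
      using f0 by simp
    ultimately have "0 < f t * exp (- I t)"
      by linarith
    then show ?thesis
      by (simp add: zero_less_mult_iff)
  qed
  have pa: "0 < a t" if "t \<in> {0..T}" for t
    by (rule positive[OF a a' cb pos(1) that])
  have pb: "0 < b t" if "t \<in> {0..T}" for t
    by (rule positive[OF b _ ca pos(2) that]) (use b' in \<open>auto simp: mult.commute\<close>)
  have "- (1 / a 0 + 1 / b 0) - 0 \<le> - (1 / a T + 1 / b T) - T"
  proof (rule has_derivative_within_mono[where f = "\<lambda>t. - (1 / a t + 1 / b t) - t"])
    fix t assume t: "t \<in> {0..T}"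
    have p: "0 < a t" "0 < b t"
      using pa pb t by auto
    show "((\<lambda>t. - (1 / a t + 1 / b t) - t) has_real_derivative a' t / (a t)\<^sup>2 + b' t / (b t)\<^sup>2 - 1) (at t within {0..T})"
      using p t by (auto intro!: derivative_eq_intros a b simp: power2_eq_square)
    have "b t / a t / 2 + a t / b t / 2 = a t * b t / 2 / (a t)\<^sup>2 + a t * b t / 2 / (b t)\<^sup>2"
      using p by (simp add: power2_eq_square)
    also have "\<dots> \<le> a' t / (a t)\<^sup>2 + b' t / (b t)\<^sup>2"
      using a'[OF t] b'[OF t] by (intro add_mono divide_right_mono) auto
    finally have "b t / a t / 2 + a t / b t / 2 \<le> a' t / (a t)\<^sup>2 + b' t / (b t)\<^sup>2" .
    moreover have "1 \<le> b t / a t / 2 + a t / b t / 2"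
      using p sum_squares_bound[of "a t" "b t"] by (simp add: field_simps power2_eq_square)
    ultimately show "0 \<le> a' t / (a t)\<^sup>2 + b' t / (b t)\<^sup>2 - 1"
      by linarith
  qed (use T in auto)
  moreover have "0 < 1 / a T + 1 / b T"
    using pa[of T] pb[of T] T by (simp add: add_pos_pos)
  ultimately show ?thesis
    by linarith
qed

text \<open>Both the function and its argument move: uniformity absorbs the change of function at
  the moving point, continuity of the limit the change of the point.\<close>

lemma tendsto_along_path:
  fixes f :: "'t \<Rightarrow> real \<Rightarrow> real"
  assumes "uniform_limit UNIV f l F" "isCont l x" "(q \<longlongrightarrow> x) F"
  shows "((\<lambda>\<tau>. f \<tau> (q \<tau>)) \<longlongrightarrow> l x) F"
proof -
  have "((\<lambda>\<tau>. f \<tau> (q \<tau>) - l (q \<tau>)) \<longlongrightarrow> 0) F"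
  proof (rule tendstoI)
    fix e :: real assume "0 < e"
    then have "\<forall>\<^sub>F \<tau> in F. \<forall>x\<in>UNIV. dist (f \<tau> x) (l x) < e"
      using assms(1) by (simp add: uniform_limit_iff)
    then show "\<forall>\<^sub>F \<tau> in F. dist (f \<tau> (q \<tau>) - l (q \<tau>)) 0 < e"
      by eventually_elim (simp add: dist_real_def)
  qed
  moreover have "((\<lambda>\<tau>. l (q \<tau>)) \<longlongrightarrow> l x) F"
    using assms(2,3) by (rule isCont_tendsto_compose)
  ultimately show ?thesis
    using tendsto_add by fastforce
qed

text \<open>The family is a continuous curve in the Banach space of bounded continuous functions,
  and the image of a compact set is bounded.\<close>

lemma uniformly_bounded_on_compact:
  fixes f :: "real \<Rightarrow> real \<Rightarrow> real"
  assumes lim: "\<And>t. t \<in> I \<Longrightarrow> uniform_limit UNIV f (f t) (at t within I)"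
    and cont: "\<And>t. t \<in> I \<Longrightarrow> continuous_on UNIV (f t)"
    and bdd: "\<And>t. t \<in> I \<Longrightarrow> bounded (range (f t))" and I: "compact I"
  obtains B where "\<And>t x. t \<in> I \<Longrightarrow> \<bar>f t x\<bar> \<le> B"
proof -
  have b: "f t \<in> bcontfun" if "t \<in> I" for t
    using cont bdd that by (auto simp: bcontfun_def)
  have "continuous_on I (\<lambda>t. Bcontfun (f t))"
    unfolding continuous_on_def
  proof
    fix t assume t: "t \<in> I"
    show "((\<lambda>t. Bcontfun (f t)) \<longlongrightarrow> Bcontfun (f t)) (at t within I)"
    proof (rule uniform_limit_tendsto_bcontfun)
      have "\<forall>\<^sub>F \<tau> in at t within I. \<tau> \<in> I"
        by (simp add: eventually_at_filter)
      then have "\<forall>\<^sub>F \<tau> in at t within I. \<forall>x\<in>UNIV. apply_bcontfun (Bcontfun (f \<tau>)) x = f \<tau> x"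
        by eventually_elim (simp add: Bcontfun_inverse b)
      then have "uniform_limit UNIV (\<lambda>t. apply_bcontfun (Bcontfun (f t))) (f t) (at t within I)"
        using lim[OF t] by (subst uniform_limit_cong) auto
      then show "uniform_limit UNIV (\<lambda>t. apply_bcontfun (Bcontfun (f t))) (apply_bcontfun (Bcontfun (f t))) (at t within I)"
        by (simp add: Bcontfun_inverse b t)
    qed
  qed
  then have "bounded ((\<lambda>t. Bcontfun (f t)) ` I)"
    using I by (intro compact_imp_bounded compact_continuous_image)
  then obtain B where B: "\<And>t. t \<in> I \<Longrightarrow> norm (Bcontfun (f t)) \<le> B"
    by (auto simp: bounded_iff)
  show ?thesis
  proof (rule that)
    show "\<bar>f t x\<bar> \<le> B" if "t \<in> I" for t x
      using order_trans[OF norm_bounded[of "Bcontfun (f t)" x] B[OF that]] by (simp add: Bcontfun_inverse b that)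
  qed
qed

section \<open>Blow-up of classical solutions\<close>

lemma continuous_on_along_path:
  fixes f :: "real \<Rightarrow> real \<Rightarrow> real"
  assumes "\<And>t. t \<in> I \<Longrightarrow> uniform_limit UNIV f (f t) (at t within I)"
    and "\<And>t. t \<in> I \<Longrightarrow> continuous_on UNIV (f t)" and q: "continuous_on I q"
  shows "continuous_on I (\<lambda>t. f t (q t))"
  unfolding continuous_on_def
proof
  fix t assume t: "t \<in> I"
  show "((\<lambda>t. f t (q t)) \<longlongrightarrow> f t (q t)) (at t within I)"
  proof (rule tendsto_along_path[OF assms(1)[OF t]])
    show "isCont (f t) (q t)"
      using assms(2)[OF t] by (simp add: continuous_on_eq_continuous_at)
    show "(q \<longlongrightarrow> q t) (at t within I)"
      using q t by (simp add: continuous_on_def)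
  qed
qed

lemma difference_quotient_le:
  fixes f :: "real \<Rightarrow> real"
  assumes f: "\<And>x. (f has_real_derivative f' x) (at x)" and B: "\<And>x. \<bar>f' x\<bar> \<le> B"
  shows "\<bar>f x - f y\<bar> \<le> B * \<bar>x - y\<bar>"
  using field_differentiable_bound[of UNIV f f' B x y] assms by auto

text \<open>What the blow-up argument uses of an H^s solution, on a compact time interval and with
  no trace of \<open>s\<close>. Regularity in time enters only as limits uniform in x; neither
  second space derivatives nor joint differentiability are assumed.\<close>

locale classical_CH =
  fixes T :: real and u ux ut :: "real \<Rightarrow> real \<Rightarrow> real"
  assumes T: "0 \<le> T"
    and u_deriv: "\<And>t x. t \<in> {0..T} \<Longrightarrow> (u t has_real_derivative ux t x) (at x)"
    and ux_cont: "\<And>t. t \<in> {0..T} \<Longrightarrow> continuous_on UNIV (ux t)"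
    and ut_cont: "\<And>t. t \<in> {0..T} \<Longrightarrow> continuous_on UNIV (ut t)"
    and u_bounded: "\<And>t. t \<in> {0..T} \<Longrightarrow> bounded (range (u t))"
    and ux_bounded: "\<And>t. t \<in> {0..T} \<Longrightarrow> bounded (range (ux t))"
    and u_lim: "\<And>t. t \<in> {0..T} \<Longrightarrow> uniform_limit UNIV u (u t) (at t within {0..T})"
    and ux_lim: "\<And>t. t \<in> {0..T} \<Longrightarrow> uniform_limit UNIV ux (ux t) (at t within {0..T})"
    and ut_lim: "\<And>t. t \<in> {0..T} \<Longrightarrow>
      uniform_limit UNIV (\<lambda>\<tau> x. (u \<tau> x - u t x) / (\<tau> - t)) (ut t) (at t within {0..T})"
    and CH: "\<And>t x. t \<in> {0..T} \<Longrightarrow> ut t x + u t x * ux t x =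
      - deriv (convolve CH_kernel (\<lambda>y. (u t y)\<^sup>2 + (ux t y)\<^sup>2 / 2)) x"
begin

definition F :: "real \<Rightarrow> real \<Rightarrow> real" where
  "F t y = (u t y)\<^sup>2 + (ux t y)\<^sup>2 / 2"

definition characteristic :: "(real \<Rightarrow> real) \<Rightarrow> bool" where
  "characteristic q \<longleftrightarrow> (\<forall>t\<in>{0..T}. (q has_real_derivative u t (q t)) (at t within {0..T}))"

lemma u_cont: "t \<in> {0..T} \<Longrightarrow> continuous_on UNIV (u t)"
  by (auto intro!: continuous_at_imp_continuous_on DERIV_isCont[OF u_deriv])

lemma F_cont: "t \<in> {0..T} \<Longrightarrow> continuous_on UNIV (F t)"
  unfolding F_def by (auto intro!: continuous_intros u_cont ux_cont)

lemma bounds: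
  obtains B where "0 \<le> B" "\<And>t x. t \<in> {0..T} \<Longrightarrow> \<bar>u t x\<bar> \<le> B" "\<And>t x. t \<in> {0..T} \<Longrightarrow> \<bar>ux t x\<bar> \<le> B"
    "\<And>t x. t \<in> {0..T} \<Longrightarrow> \<bar>F t x\<bar> \<le> 2 * B\<^sup>2"
proof -
  obtain B1 where B1: "\<And>t x. t \<in> {0..T} \<Longrightarrow> \<bar>u t x\<bar> \<le> B1"
    using uniformly_bounded_on_compact[OF u_lim u_cont u_bounded compact_Icc] by blast
  obtain B2 where B2: "\<And>t x. t \<in> {0..T} \<Longrightarrow> \<bar>ux t x\<bar> \<le> B2"
    using uniformly_bounded_on_compact[OF ux_lim ux_cont ux_bounded compact_Icc] by blast
  define B where "B = max 0 (max B1 B2)"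
  have B: "\<bar>u t x\<bar> \<le> B" "\<bar>ux t x\<bar> \<le> B" if "t \<in> {0..T}" for t x
    using B1[OF that, of x] B2[OF that, of x] by (auto simp: B_def)
  have "\<bar>F t x\<bar> \<le> 2 * B\<^sup>2" if "t \<in> {0..T}" for t x
  proof -
    have "(u t x)\<^sup>2 \<le> B\<^sup>2" "(ux t x)\<^sup>2 \<le> B\<^sup>2"
      using B[OF that, of x] by (auto simp: abs_le_square_iff[symmetric] intro: order_trans[OF _ abs_ge_self])
    then show ?thesis
      unfolding F_def using zero_le_power2[of "u t x"] zero_le_power2[of "ux t x"] zero_le_power2[of B] by linarith
  qed
  with B show ?thesis
    by (intro that[of B]) (auto simp: B_def)
qed

lemma F_lim:
  assumes t: "t \<in> {0..T}"
  shows "uniform_limit UNIV F (F t) (at t within {0..T})"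
proof (rule uniform_limitI)
  fix e :: real assume e: "0 < e"
  obtain B where B: "0 \<le> B" "\<And>t x. t \<in> {0..T} \<Longrightarrow> \<bar>u t x\<bar> \<le> B" "\<And>t x. t \<in> {0..T} \<Longrightarrow> \<bar>ux t x\<bar> \<le> B"
    by (rule bounds) blast
  \<comment> \<open>The two squares together change by at most 2 B d + B d, which is below (4 B + 4)
    d; the summand 4 keeps the denominator positive when B = 0.\<close>
  define d where "d = e / (4 * B + 4)"
  have d: "0 < d" "d * (4 * B + 4) = e"
    using e B(1) by (auto simp: d_def)
  have "\<forall>\<^sub>F \<tau> in at t within {0..T}. \<tau> \<in> {0..T}"
    by (simp add: eventually_at_filter)
  with uniform_limitD[OF u_lim[OF t] d(1)] uniform_limitD[OF ux_lim[OF t] d(1)]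
  show "\<forall>\<^sub>F \<tau> in at t within {0..T}. \<forall>x\<in>UNIV. dist (F \<tau> x) (F t x) < e"
  proof eventually_elim
    case (elim \<tau>)
    show ?case
    proof
      fix x
      have sq: "\<bar>a\<^sup>2 - b\<^sup>2\<bar> \<le> d * (2 * B)" if "\<bar>a - b\<bar> < d" "\<bar>a\<bar> \<le> B" "\<bar>b\<bar> \<le> B" for a b :: real
      proof -
        have "\<bar>a\<^sup>2 - b\<^sup>2\<bar> = \<bar>a - b\<bar> * \<bar>a + b\<bar>"
          by (simp add: power2_eq_square square_diff_square_factored abs_mult mult.commute)
        also have "\<dots> \<le> d * (2 * B)"
          using that by (intro mult_mono) auto
        finally show ?thesis .
      qed
      have "\<bar>(u \<tau> x)\<^sup>2 - (u t x)\<^sup>2\<bar> \<le> d * (2 * B)" "\<bar>(ux \<tau> x)\<^sup>2 - (ux t x)\<^sup>2\<bar> \<le> d * (2 * B)"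
        using elim B(2,3) t by (auto intro!: sq simp: dist_real_def)
      moreover have "F \<tau> x - F t x = ((u \<tau> x)\<^sup>2 - (u t x)\<^sup>2) + ((ux \<tau> x)\<^sup>2 - (ux t x)\<^sup>2) / 2"
        by (simp add: F_def field_simps)
      moreover have "\<bar>a + b / 2\<bar> \<le> c + c / 2" if "\<bar>a\<bar> \<le> c" "\<bar>b\<bar> \<le> c" for a b c :: real
        using that by linarith
      ultimately have "\<bar>F \<tau> x - F t x\<bar> \<le> d * (2 * B) + d * (2 * B) / 2"
        by (simp only:)
      also have "\<dots> < d * (4 * B + 4)"
        using d(1) B(1) by (auto simp: algebra_simps intro: add_nonneg_pos)
      finally show "dist (F \<tau> x) (F t x) < e"
        using d(2) by (simp add: dist_real_def)
    qed
  qed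
qed

lemma
  assumes t: "t \<in> {0..T}"
  shows laplace_left_lim: "uniform_limit UNIV (\<lambda>\<tau>. laplace_left (F \<tau>)) (laplace_left (F t)) (at t within {0..T})"
    and laplace_right_lim: "uniform_limit UNIV (\<lambda>\<tau>. laplace_right (F \<tau>)) (laplace_right (F t)) (at t within {0..T})"
proof -
  obtain B where B: "\<And>t x. t \<in> {0..T} \<Longrightarrow> \<bar>F t x\<bar> \<le> 2 * B\<^sup>2"
    by (rule bounds) blast
  have *: "\<forall>\<^sub>F \<tau> in at t within {0..T}. \<forall>x\<in>UNIV. dist (laplace_left (F \<tau>) x) (laplace_left (F t) x) < e \<and>
      dist (laplace_right (F \<tau>) x) (laplace_right (F t) x) < e" if "0 < e" for e
  proof -
    have e: "0 < e / 2"
      using that by simp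
    have "\<forall>\<^sub>F \<tau> in at t within {0..T}. \<tau> \<in> {0..T}"
      by (simp add: eventually_at_filter)
    with uniform_limitD[OF F_lim[OF t] e] show ?thesis
    proof eventually_elim
      case (elim \<tau>)
      have "\<bar>F \<tau> x - F t x\<bar> \<le> e / 2" for x
        using elim by (auto simp: dist_real_def intro: less_imp_le)
      note d = laplace_left_diff_le[OF F_cont[OF elim(2)] B[OF elim(2)] F_cont[OF t] B[OF t] this]
        laplace_right_diff_le[OF F_cont[OF elim(2)] B[OF elim(2)] F_cont[OF t] B[OF t] this]
      have "e / 2 < e"
        using that by simp
      then show ?case
        unfolding dist_real_def by (intro ballI conjI le_less_trans[OF d(1)] le_less_trans[OF d(2)])
    qed
  qed
  show "uniform_limit UNIV (\<lambda>\<tau>. laplace_left (F \<tau>)) (laplace_left (F t)) (at t within {0..T})"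
    by (rule uniform_limitI, drule *, erule eventually_mono) simp
  show "uniform_limit UNIV (\<lambda>\<tau>. laplace_right (F \<tau>)) (laplace_right (F t)) (at t within {0..T})"
    by (rule uniform_limitI, drule *, erule eventually_mono) simp
qed

lemma
  assumes "t \<in> {0..T}"
  shows has_derivative_left: "(laplace_left (F t) has_real_derivative F t x - laplace_left (F t) x) (at x)"
    and has_derivative_right: "(laplace_right (F t) has_real_derivative laplace_right (F t) x - F t x) (at x)"
    and laplace_left_cont: "continuous_on UNIV (laplace_left (F t))"
    and laplace_right_cont: "continuous_on UNIV (laplace_right (F t))"
proof -
  obtain B where B: "\<And>t x. t \<in> {0..T} \<Longrightarrow> \<bar>F t x\<bar> \<le> 2 * B\<^sup>2"
    by (rule bounds) blast
  have l: "(laplace_left (F t) has_real_derivative F t x - laplace_left (F t) x) (at x)" for x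
    by (rule has_derivative_laplace_left[OF F_cont B]) (use assms in auto)
  have r: "(laplace_right (F t) has_real_derivative laplace_right (F t) x - F t x) (at x)" for x
    by (rule has_derivative_laplace_right[OF F_cont B]) (use assms in auto)
  show "(laplace_left (F t) has_real_derivative F t x - laplace_left (F t) x) (at x)"
    "(laplace_right (F t) has_real_derivative laplace_right (F t) x - F t x) (at x)"
    by (fact l r)+
  show "continuous_on UNIV (laplace_left (F t))" "continuous_on UNIV (laplace_right (F t))"
    using l r by (meson DERIV_isCont continuous_at_imp_continuous_on)+
qed

lemma laplace_ge:
  assumes "t \<in> {0..T}"
  shows "(u t x)\<^sup>2 / 2 \<le> laplace_left (F t) x" "(u t x)\<^sup>2 / 2 \<le> laplace_right (F t) x"
proof -
  obtain B where B: "\<And>t x. t \<in> {0..T} \<Longrightarrow> \<bar>u t x\<bar> \<le> B" "\<And>t x. t \<in> {0..T} \<Longrightarrow> \<bar>ux t x\<bar> \<le> B"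
    by (rule bounds) blast
  have F: "F t = (\<lambda>y. (u t y)\<^sup>2 + (ux t y)\<^sup>2 / 2)"
    by (simp add: F_def fun_eq_iff)
  show "(u t x)\<^sup>2 / 2 \<le> laplace_left (F t) x"
    unfolding F by (rule laplace_left_ge[OF u_deriv ux_cont B]) (use assms in auto)
  show "(u t x)\<^sup>2 / 2 \<le> laplace_right (F t) x"
    unfolding F by (rule laplace_right_ge[OF u_deriv ux_cont B]) (use assms in auto)
qed

lemma CH':
  assumes t: "t \<in> {0..T}"
  shows "ut t x + u t x * ux t x = (laplace_left (F t) x - laplace_right (F t) x) / 2"
proof -
  obtain B where B: "\<And>t x. t \<in> {0..T} \<Longrightarrow> \<bar>F t x\<bar> \<le> 2 * B\<^sup>2"
    by (rule bounds) blast
  show ?thesis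
    unfolding CH[OF t] F_def[symmetric, abs_def]
    by (subst deriv_convolve_CH_kernel[OF F_cont[OF t] B[OF t]]) (simp add: field_simps)
qed

lemma characteristic_cont: "characteristic q \<Longrightarrow> continuous_on {0..T} q"
  unfolding characteristic_def continuous_on_eq_continuous_within by (blast intro: DERIV_continuous)

lemma characteristic_exists:
  obtains q where "characteristic q" "q 0 = x0"
proof -
  obtain B where B: "\<And>t x. t \<in> {0..T} \<Longrightarrow> \<bar>u t x\<bar> \<le> B" "\<And>t x. t \<in> {0..T} \<Longrightarrow> \<bar>ux t x\<bar> \<le> B"
    by (rule bounds) blast
  obtain q where "q 0 = x0" "\<And>t. t \<in> {0..T} \<Longrightarrow> (q has_real_derivative u t (q t)) (at t within {0..T})"
  proof (rule ode_solution_exists[OF T])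
    show "continuous_on {0..T} (\<lambda>t. u t (w t))" if "continuous_on {0..T} w" for w
      by (rule continuous_on_along_path[OF u_lim u_cont that])
    show "\<bar>u t x - u t y\<bar> \<le> B * \<bar>x - y\<bar>" if "t \<in> {0..T}" for t x y
      using u_deriv B that by (intro difference_quotient_le) auto
  qed (use B in blast)+
  then show ?thesis
    by (intro that[of q]) (auto simp: characteristic_def)
qed

text \<open>The increment is split into a change of time at the moving point and a change of place
  at the fixed time \<open>t\<close>. The first quotient converges by uniformity in x, the second by
  the chain rule, so joint differentiability is avoided.\<close>

lemma u_along_characteristic:
  assumes q: "characteristic q" and t: "t \<in> {0..T}"
  shows "((\<lambda>t. u t (q t)) has_real_derivative
    (laplace_left (F t) (q t) - laplace_right (F t) (q t)) / 2) (at t within {0..T})"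
proof -
  have qd: "(q has_real_derivative u t (q t)) (at t within {0..T})"
    using q t by (simp add: characteristic_def)
  have "(q \<longlongrightarrow> q t) (at t within {0..T})"
    using characteristic_cont[OF q] t by (simp add: continuous_on_def)
  then have 1: "((\<lambda>\<tau>. (u \<tau> (q \<tau>) - u t (q \<tau>)) / (\<tau> - t)) \<longlongrightarrow> ut t (q t)) (at t within {0..T})"
    using ut_cont[OF t] by (intro tendsto_along_path[OF ut_lim[OF t]]) (auto simp: continuous_on_eq_continuous_at)
  have "((\<lambda>\<tau>. u t (q \<tau>)) has_real_derivative ux t (q t) * u t (q t)) (at t within {0..T})"
    by (rule DERIV_chain2[OF u_deriv[OF t] qd])
  then have 2: "((\<lambda>\<tau>. (u t (q \<tau>) - u t (q t)) / (\<tau> - t)) \<longlongrightarrow> ux t (q t) * u t (q t)) (at t within {0..T})"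
    by (simp add: has_field_derivative_iff)
  have "((\<lambda>\<tau>. (u \<tau> (q \<tau>) - u t (q t)) / (\<tau> - t)) \<longlongrightarrow> ut t (q t) + ux t (q t) * u t (q t)) (at t within {0..T})"
    using tendsto_add[OF 1 2] by (simp flip: add_divide_distrib)
  then show ?thesis
    unfolding has_field_derivative_iff CH'[OF t, symmetric] by (simp only: mult.commute)
qed

text \<open>A two-sided Gronwall estimate. The upper bound lets characteristics started ever closer
  to \<open>q\<close> converge to it; the lower bound keeps them apart from \<open>q\<close>, so
  that quotients over their distance can be formed.\<close>

lemma characteristic_separation:
  assumes q: "characteristic q" and p: "characteristic p" and t: "t \<in> {0..T}"
    and B: "\<And>t x. t \<in> {0..T} \<Longrightarrow> \<bar>ux t x\<bar> \<le> B"
  shows "\<bar>p t - q t\<bar> \<le> exp (B * t) * \<bar>p 0 - q 0\<bar>" "\<bar>p 0 - q 0\<bar> \<le> exp (B * t) * \<bar>p t - q t\<bar>"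
proof -
  define z where "z = (\<lambda>t. p t - q t)"
  define w where "w = (\<lambda>t. u t (p t) - u t (q t))"
  have z: "(z has_real_derivative w t) (at t within {0..T})" if "t \<in> {0..T}" for t
    using p q that unfolding z_def w_def characteristic_def by (auto intro!: DERIV_diff)
  have "\<bar>w t\<bar> \<le> B * \<bar>z t\<bar>" if "t \<in> {0..T}" for t
    unfolding w_def z_def using u_deriv B that by (intro difference_quotient_le) auto
  then have zw: "\<bar>z t * w t\<bar> \<le> B * (z t)\<^sup>2" if "t \<in> {0..T}" for t
    using mult_left_mono[of "\<bar>w t\<bar>" "B * \<bar>z t\<bar>" "\<bar>z t\<bar>"] that
    by (simp add: abs_mult power2_eq_square mult_ac)
  \<comment> \<open>Squares avoid differentiating an absolute value. The sign \<open>c\<close>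
    treats both bounds at once: 1 gives the lower bound for the separation, -1 the upper
    one.\<close>
  have mono: "(z 0)\<^sup>2 * exp (2 * c * B * 0) * c \<le> (z t)\<^sup>2 * exp (2 * c * B * t) * c" if c: "c = 1 \<or> c = - 1" for c
  proof (rule has_derivative_within_mono[where f = "\<lambda>t. (z t)\<^sup>2 * exp (2 * c * B * t) * c"])
    fix t assume t: "t \<in> {0..T}"
    show "((\<lambda>t. (z t)\<^sup>2 * exp (2 * c * B * t) * c) has_real_derivative
        2 * exp (2 * c * B * t) * (c * (z t * w t) + c * c * (B * (z t)\<^sup>2))) (at t within {0..T})"
      using t by (auto intro!: derivative_eq_intros z simp: algebra_simps power2_eq_square)
    show "0 \<le> 2 * exp (2 * c * B * t) * (c * (z t * w t) + c * c * (B * (z t)\<^sup>2))"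
      using zw[OF t] c by (intro mult_nonneg_nonneg) auto
  qed (use t in auto)
  have sq: "(z t)\<^sup>2 * exp (2 * B * t) = (exp (B * t) * z t)\<^sup>2"
    by (simp add: power_mult_distrib power2_eq_square exp_add[symmetric] mult_ac)
  have "\<bar>z 0\<bar> \<le> \<bar>exp (B * t) * z t\<bar>"
    using mono[of 1] sq by (simp add: abs_le_square_iff)
  then show "\<bar>p 0 - q 0\<bar> \<le> exp (B * t) * \<bar>p t - q t\<bar>"
    by (simp add: z_def abs_mult)
  have sq': "(z t)\<^sup>2 * exp (- (2 * B * t)) = (exp (- (B * t)) * z t)\<^sup>2"
    by (simp add: power_mult_distrib power2_eq_square exp_add[symmetric] mult_ac)
  have "\<bar>exp (- (B * t)) * z t\<bar> \<le> \<bar>z 0\<bar>"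
    using mono[of "- 1"] sq' by (simp add: abs_le_square_iff)
  then show "\<bar>p t - q t\<bar> \<le> exp (B * t) * \<bar>p 0 - q 0\<bar>"
    by (simp add: z_def abs_mult exp_minus field_simps)
qed

text \<open>
  Only first derivatives of \<open>u t\<close> are available, so the evolution of \<open>ux\<close> along a characteristic
  \<open>q\<close> is found from the quotient \<open>D = (u(p) - u(q)) / (p - q)\<close> for a nearby characteristic \<open>p\<close>,
  which satisfies \<open>D' = - (P\<^sub>x(p) - P\<^sub>x(q)) / (p - q) - D\<^sup>2\<close>, where \<open>P = convolve CH_kernel (F t)\<close>.
\<close>

lemma ux_along_characteristic:
  assumes q: "characteristic q" and t: "t \<in> {0..T}"
  shows "((\<lambda>t. ux t (q t)) has_real_derivative
    F t (q t) - (laplace_left (F t) (q t) + laplace_right (F t) (q t)) / 2 - (ux t (q t))\<^sup>2) (at t within {0..T})"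
proof -
  obtain B where B: "0 \<le> B" "\<And>t x. t \<in> {0..T} \<Longrightarrow> \<bar>ux t x\<bar> \<le> B"
    "\<And>t x. t \<in> {0..T} \<Longrightarrow> \<bar>F t x\<bar> \<le> 2 * B\<^sup>2"
    by (rule bounds) blast
  have "\<exists>p. characteristic p \<and> p 0 = q 0 + 1 / real (Suc n)" for n
    by (rule characteristic_exists[of "q 0 + 1 / real (Suc n)"]) blast
  then obtain p where p: "\<And>n. characteristic (p n)" "\<And>n. p n 0 = q 0 + 1 / real (Suc n)"
    by metis
  have ne: "p n t - q t \<noteq> 0" if "t \<in> {0..T}" for n t
    using characteristic_separation(2)[OF q p(1) that B(2), of n] p(2)[of n] by auto
  have p_lim: "filterlim (\<lambda>n. p n t) (at (q t)) sequentially" if t: "t \<in> {0..T}" for t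
  proof -
    have "(\<lambda>n. p n t - q t) \<longlonglongrightarrow> 0"
    proof (rule Lim_null_comparison)
      show "\<forall>\<^sub>F n in sequentially. norm (p n t - q t) \<le> exp (B * t) * (1 / real (Suc n))"
        using characteristic_separation(1)[OF q p(1) t B(2)] p(2) by (intro always_eventually allI) simp
      show "(\<lambda>n. exp (B * t) * (1 / real (Suc n))) \<longlonglongrightarrow> 0"
        using tendsto_mult[OF tendsto_const LIMSEQ_inverse_real_of_nat] by (simp add: field_simps)
    qed
    then show ?thesis
      using ne[OF t] by (auto simp: filterlim_at LIM_zero_iff intro: always_eventually)
  qed
  \<comment> \<open>With P = (L + R)/2 for the convolution, \<open>H\<close> is - P_x and
    \<open>H'\<close> is - P_xx = F - P.\<close>
  define H where "H = (\<lambda>t x. (laplace_left (F t) x - laplace_right (F t) x) / 2)"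
  define H' where "H' = (\<lambda>t x. F t x - (laplace_left (F t) x + laplace_right (F t) x) / 2)"
  have H: "(H t has_real_derivative H' t x) (at x)" if "t \<in> {0..T}" for t x
  proof -
    have "(H t has_real_derivative ((F t x - laplace_left (F t) x) - (laplace_right (F t) x - F t x)) / 2) (at x)"
      unfolding H_def using that by (intro DERIV_cdivide DERIV_diff has_derivative_left has_derivative_right)
    moreover have "((F t x - laplace_left (F t) x) - (laplace_right (F t) x - F t x)) / 2 = H' t x"
      by (simp add: H'_def field_simps)
    ultimately show ?thesis
      by simp
  qed
  have H'_le: "\<bar>H' t x\<bar> \<le> 4 * B\<^sup>2" if "t \<in> {0..T}" for t x
  proof -
    have "\<bar>laplace_left (F t) x\<bar> \<le> 2 * B\<^sup>2" "\<bar>laplace_right (F t) x\<bar> \<le> 2 * B\<^sup>2"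
      by (rule abs_laplace_left_le abs_laplace_right_le; use F_cont B that in blast)+
    moreover have "\<bar>a - (b + c) / 2\<bar> \<le> 2 * d" if "\<bar>a\<bar> \<le> d" "\<bar>b\<bar> \<le> d" "\<bar>c\<bar> \<le> d" for a b c d :: real
      using that unfolding add_divide_distrib by linarith
    ultimately have "\<bar>H' t x\<bar> \<le> 2 * (2 * B\<^sup>2)"
      using B(3)[OF that, of x] unfolding H'_def by blast
    then show ?thesis
      by simp
  qed
  define D where "D = (\<lambda>n t. (u t (p n t) - u t (q t)) / (p n t - q t))"
  define R where "R = (\<lambda>n t. (H t (p n t) - H t (q t)) / (p n t - q t))"
  \<comment> \<open>The derivative of the denominator is the numerator of \<open>D n\<close>, which
    is where the square comes from.\<close>
  have D_deriv: "(D n has_real_derivative R n t - (D n t)\<^sup>2) (at t within {0..T})" if t: "t \<in> {0..T}" for n t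
  proof -
    have "((\<lambda>t. u t (p n t) - u t (q t)) has_real_derivative H t (p n t) - H t (q t)) (at t within {0..T})"
      unfolding H_def by (intro DERIV_diff u_along_characteristic p q t)
    moreover have "((\<lambda>t. p n t - q t) has_real_derivative u t (p n t) - u t (q t)) (at t within {0..T})"
      using p(1)[of n] q t by (intro DERIV_diff) (auto simp: characteristic_def)
    ultimately have "(D n has_real_derivative ((H t (p n t) - H t (q t)) * (p n t - q t) -
        (u t (p n t) - u t (q t)) * (u t (p n t) - u t (q t))) / ((p n t - q t) * (p n t - q t))) (at t within {0..T})"
      unfolding D_def by (rule DERIV_divide) (rule ne[OF t])
    moreover have quot: "(h * z - w * w) / (z * z) = h / z - (w / z)\<^sup>2" if "z \<noteq> 0" for h w z :: real
      using that by (simp add: field_simps power2_eq_square)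
    have "((H t (p n t) - H t (q t)) * (p n t - q t) -
        (u t (p n t) - u t (q t)) * (u t (p n t) - u t (q t))) / ((p n t - q t) * (p n t - q t)) = R n t - (D n t)\<^sup>2"
      unfolding R_def D_def by (rule quot) (rule ne[OF t])
    ultimately show ?thesis
      by simp
  qed
  have D_lim: "(\<lambda>n. D n t) \<longlonglongrightarrow> ux t (q t)" if t: "t \<in> {0..T}" for t
    unfolding D_def
    using u_deriv[OF t, of "q t"] p_lim[OF t] unfolding has_field_derivative_iff by (rule filterlim_compose)
  have R_lim: "(\<lambda>n. R n t) \<longlonglongrightarrow> H' t (q t)" if t: "t \<in> {0..T}" for t
    unfolding R_def
    using H[OF t, of "q t"] p_lim[OF t] unfolding has_field_derivative_iff by (rule filterlim_compose)
  have D_le: "\<bar>D n t\<bar> \<le> B" if "t \<in> {0..T}" for n t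
    using difference_quotient_le[OF u_deriv[OF that] B(2)[OF that], of "p n t" "q t"] ne[OF that, of n]
    by (simp add: D_def field_simps)
  have R_le: "\<bar>R n t\<bar> \<le> 4 * B\<^sup>2" if "t \<in> {0..T}" for n t
    using difference_quotient_le[OF H[OF that] H'_le[OF that], of "p n t" "q t"] ne[OF that, of n]
    by (simp add: R_def field_simps)
  define g where "g = (\<lambda>t. H' t (q t) - (ux t (q t))\<^sup>2)"
  \<comment> \<open>Pointwise convergence of \<open>D n\<close> says nothing about derivatives, so
    the limit is taken in the integrated equation. Dominated convergence applies with 5 B^2 = 4 B^2
    + B^2, from \<open>R_le\<close> and \<open>D_le\<close>.\<close>
  have g_int: "ux t (q t) = ux 0 (q 0) + integral {0..t} g" if t: "t \<in> {0..T}" for t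
  proof -
    have ftc: "((\<lambda>s. R n s - (D n s)\<^sup>2) has_integral D n t - D n 0) {0..t}" for n
    proof (rule fundamental_theorem_of_calculus)
      show "0 \<le> t"
        using t by simp
      show "(D n has_vector_derivative R n s - (D n s)\<^sup>2) (at s within {0..t})" if "s \<in> {0..t}" for s
        using DERIV_subset[OF D_deriv, of s "{0..t}"] that t
        by (simp flip: has_real_derivative_iff_has_vector_derivative)
    qed
    have "(\<lambda>n. integral {0..t} (\<lambda>s. R n s - (D n s)\<^sup>2)) \<longlonglongrightarrow> integral {0..t} g"
    proof (rule dominated_convergence(2))
      show "(\<lambda>s. R n s - (D n s)\<^sup>2) integrable_on {0..t}" for n
        using ftc by (rule has_integral_integrable)
      show "(\<lambda>s. 5 * B\<^sup>2) integrable_on {0..t}"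
        by (rule integrable_const_ivl)
      show "norm (R n s - (D n s)\<^sup>2) \<le> 5 * B\<^sup>2" if "s \<in> {0..t}" for n s
      proof -
        have s: "s \<in> {0..T}"
          using that t by auto
        have "(D n s)\<^sup>2 \<le> B\<^sup>2"
          using D_le[OF s, of n] B(1) by (simp add: abs_le_square_iff[symmetric])
        then show ?thesis
          using R_le[OF s, of n] zero_le_power2[of "D n s"] unfolding real_norm_def by linarith
      qed
      show "(\<lambda>n. R n s - (D n s)\<^sup>2) \<longlonglongrightarrow> g s" if "s \<in> {0..t}" for s
        unfolding g_def using that t by (intro tendsto_diff tendsto_power R_lim D_lim) auto
    qed
    then have "(\<lambda>n. D n t - D n 0) \<longlonglongrightarrow> integral {0..t} g"
      by (simp only: integral_unique[OF ftc])
    moreover have "(\<lambda>n. D n t - D n 0) \<longlonglongrightarrow> ux t (q t) - ux 0 (q 0)"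
      using t T by (intro tendsto_diff D_lim) auto
    ultimately have "integral {0..t} g = ux t (q t) - ux 0 (q 0)"
      by (rule LIMSEQ_unique)
    then show ?thesis
      by simp
  qed
  note qc = characteristic_cont[OF q]
  \<comment> \<open>Continuity of \<open>g\<close> is what turns the integral formula back into a
    derivative at every time.\<close>
  have "continuous_on {0..T} (\<lambda>t. F t (q t))" "continuous_on {0..T} (\<lambda>t. ux t (q t))"
    "continuous_on {0..T} (\<lambda>t. laplace_left (F t) (q t))" "continuous_on {0..T} (\<lambda>t. laplace_right (F t) (q t))"
    by (rule continuous_on_along_path[OF F_lim F_cont qc] continuous_on_along_path[OF ux_lim ux_cont qc]
        continuous_on_along_path[OF laplace_left_lim laplace_left_cont qc]
        continuous_on_along_path[OF laplace_right_lim laplace_right_cont qc]; assumption)+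
  then have "continuous_on {0..T} g"
    unfolding g_def H'_def by (intro continuous_intros) auto
  then have "((\<lambda>t. ux 0 (q 0) + integral {0..t} g) has_real_derivative 0 + g t) (at t within {0..T})"
    by (intro DERIV_add DERIV_const integral_has_real_derivative t)
  then have "((\<lambda>t. ux t (q t)) has_real_derivative 0 + g t) (at t within {0..T})"
    by (rule has_field_derivative_transform_within[where d = 1]) (use t in \<open>simp_all add: g_int[symmetric]\<close>)
  then show ?thesis
    by (simp add: g_def H'_def)
qed

theorem lifespan_bound:
  assumes "ux 0 x0 < - \<bar>u 0 x0\<bar>"
  shows "T < 1 / (u 0 x0 - ux 0 x0) + 1 / (- u 0 x0 - ux 0 x0)"
proof -
  obtain q where q: "characteristic q" "q 0 = x0"
    by (rule characteristic_exists)
  let ?L = "\<lambda>t. laplace_left (F t) (q t)" and ?R = "\<lambda>t. laplace_right (F t) (q t)"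
  let ?U = "\<lambda>t. u t (q t)" and ?V = "\<lambda>t. ux t (q t)"
  have "T < 1 / (?U 0 - ?V 0) + 1 / (- ?U 0 - ?V 0)"
  proof (rule Riccati_pair_blowup[OF T])
    fix t assume t: "t \<in> {0..T}"
    note U = u_along_characteristic[OF q(1) t] and V = ux_along_characteristic[OF q(1) t]
    show "((\<lambda>t. ?U t - ?V t) has_real_derivative ?L t - (?U t)\<^sup>2 + (?V t)\<^sup>2 / 2) (at t within {0..T})"
      by (rule DERIV_cong[OF DERIV_diff[OF U V]]) (simp add: F_def field_simps)
    show "((\<lambda>t. - ?U t - ?V t) has_real_derivative ?R t - (?U t)\<^sup>2 + (?V t)\<^sup>2 / 2) (at t within {0..T})"
      by (rule DERIV_cong[OF DERIV_diff[OF DERIV_minus[OF U] V]]) (simp add: F_def field_simps)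
    have "(?U t - ?V t) * (- ?U t - ?V t) = (?V t)\<^sup>2 - (?U t)\<^sup>2"
      by (simp add: algebra_simps power2_eq_square)
    then show "(?U t - ?V t) * (- ?U t - ?V t) / 2 \<le> ?L t - (?U t)\<^sup>2 + (?V t)\<^sup>2 / 2"
      "(?U t - ?V t) * (- ?U t - ?V t) / 2 \<le> ?R t - (?U t)\<^sup>2 + (?V t)\<^sup>2 / 2"
      using laplace_ge[OF t, of "q t"] by (simp_all add: field_simps)
  qed (use assms q(2) in auto)
  then show ?thesis
    by (simp add: q(2))
qed

end

section \<open>From Sobolev to classical solutions\<close>

lemma sobolev_space_diff:
  assumes "f \<in> sobolev_space s" "g \<in> sobolev_space s"
  shows "(\<lambda>x. f x - g x) \<in> sobolev_space s"
  using sobolev_space_lincomb[OF assms, of 1 "- 1"] by simp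

lemma uniform_limit_norm_bound:
  fixes f :: "'t \<Rightarrow> 'x \<Rightarrow> real"
  assumes N: "(N \<longlongrightarrow> 0) F" and le: "\<forall>\<^sub>F \<tau> in F. \<forall>x. \<bar>f \<tau> x - l x\<bar> \<le> C * N \<tau>"
  shows "uniform_limit UNIV f l F"
proof (rule uniform_limitI)
  fix e :: real assume "0 < e"
  have "((\<lambda>\<tau>. C * N \<tau>) \<longlongrightarrow> C * 0) F"
    by (intro tendsto_mult tendsto_const N)
  then have "\<forall>\<^sub>F \<tau> in F. C * N \<tau> < e"
    using \<open>0 < e\<close> by (intro order_tendstoD(2)) auto
  with le show "\<forall>\<^sub>F \<tau> in F. \<forall>x\<in>UNIV. dist (f \<tau> x) (l x) < e"
    by eventually_elim (auto simp: dist_real_def intro: le_less_trans)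
qed

lemma sobolev_continuous_uniform_limit:
  assumes u: "sobolev_continuous_on s I u" and t: "t \<in> I"
  shows "1 / 2 < s \<Longrightarrow> uniform_limit UNIV u (u t) (at t within I)"
    and "3 / 2 < s \<Longrightarrow> uniform_limit UNIV (\<lambda>t. deriv (u t)) (deriv (u t)) (at t within I)"
proof -
  have I: "\<forall>\<^sub>F \<tau> in at t within I. \<tau> \<in> I"
    by (simp add: eventually_at_filter)
  have us: "u \<tau> \<in> sobolev_space s" if "\<tau> \<in> I" for \<tau>
    using u that by (simp add: sobolev_continuous_on_def)
  have N: "((\<lambda>\<tau>. sobolev_norm s (\<lambda>x. u \<tau> x - u t x)) \<longlongrightarrow> 0) (at t within I)"
    using u t by (simp add: sobolev_continuous_on_def)
  show "uniform_limit UNIV u (u t) (at t within I)" if s: "1 / 2 < s"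
  proof -
    obtain C where C: "\<And>f x. f \<in> sobolev_space s \<Longrightarrow> \<bar>f x\<bar> \<le> C * sobolev_norm s f"
      using sobolev_sup_bound[OF s] by blast
    show ?thesis
    proof (rule uniform_limit_norm_bound[OF N])
      show "\<forall>\<^sub>F \<tau> in at t within I. \<forall>x. \<bar>u \<tau> x - u t x\<bar> \<le> C * sobolev_norm s (\<lambda>x. u \<tau> x - u t x)"
        using I by eventually_elim (intro allI C sobolev_space_diff us t)
    qed
  qed
  show "uniform_limit UNIV (\<lambda>t. deriv (u t)) (deriv (u t)) (at t within I)" if s: "3 / 2 < s"
  proof -
    obtain C where C: "\<And>f x. f \<in> sobolev_space s \<Longrightarrow> \<bar>deriv f x\<bar> \<le> C * sobolev_norm s f"
      using sobolev_deriv_sup_bound[OF s] by blast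
    have d: "deriv (\<lambda>x. u \<tau> x - u t x) x = deriv (u \<tau>) x - deriv (u t) x" if "\<tau> \<in> I" for \<tau> x
      by (intro DERIV_imp_deriv DERIV_diff sobolev_deriv(1)[OF s] us that t)
    show ?thesis
    proof (rule uniform_limit_norm_bound[OF N])
      show "\<forall>\<^sub>F \<tau> in at t within I. \<forall>x. \<bar>deriv (u \<tau>) x - deriv (u t) x\<bar> \<le> C * sobolev_norm s (\<lambda>x. u \<tau> x - u t x)"
        using I
      proof eventually_elim
        case (elim \<tau>)
        show ?case
          unfolding d[OF elim, symmetric] by (intro allI C sobolev_space_diff us elim t)
      qed
    qed
  qed
qed

text \<open>Applied with s - 1 in place of \<open>s\<close>: the time derivative exists only in the
  weaker norm, which for s > 3/2 still controls the sup norm.\<close>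

lemma sobolev_derivative_uniform_limit:
  assumes u: "sobolev_has_derivative_on s I u u_t" and t: "t \<in> I" and s: "1 / 2 < s"
  shows "uniform_limit UNIV (\<lambda>\<tau> x. (u \<tau> x - u t x) / (\<tau> - t)) (u_t t) (at t within I)"
proof -
  obtain C where C: "\<And>f x. f \<in> sobolev_space s \<Longrightarrow> \<bar>f x\<bar> \<le> C * sobolev_norm s f"
    using sobolev_sup_bound[OF s] by blast
  have us: "u \<tau> \<in> sobolev_space s" "u_t \<tau> \<in> sobolev_space s" if "\<tau> \<in> I" for \<tau>
    using u that by (simp_all add: sobolev_has_derivative_on_def)
  \<comment> \<open>This covers \<tau> = t as well: there the quotient and the coefficient
    \<open>1 / (\<tau> - t)\<close> are both 0, by the convention for division by 0.\<close>
  have mem: "(\<lambda>x. (u \<tau> x - u t x) / (\<tau> - t) - u_t t x) \<in> sobolev_space s" if "\<tau> \<in> I" for \<tau>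
    using sobolev_space_lincomb[OF sobolev_space_diff[OF us(1)[OF that] us(1)[OF t]] us(2)[OF t], of "1 / (\<tau> - t)" "- 1"]
    by simp
  have N: "((\<lambda>\<tau>. sobolev_norm s (\<lambda>x. (u \<tau> x - u t x) / (\<tau> - t) - u_t t x)) \<longlongrightarrow> 0) (at t within I)"
    using u t by (simp add: sobolev_has_derivative_on_def)
  have "\<forall>\<^sub>F \<tau> in at t within I. \<tau> \<in> I"
    by (simp add: eventually_at_filter)
  then have "\<forall>\<^sub>F \<tau> in at t within I. \<forall>x. \<bar>(u \<tau> x - u t x) / (\<tau> - t) - u_t t x\<bar>
      \<le> C * sobolev_norm s (\<lambda>x. (u \<tau> x - u t x) / (\<tau> - t) - u_t t x)"
    by eventually_elim (intro allI C mem)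
  then show ?thesis
    by (rule uniform_limit_norm_bound[OF N])
qed

lemma CH_solution_classical:
  assumes s: "3 / 2 < s" and T: "0 \<le> T" "ereal T < Tmax" and sol: "CH_solution s u0 Tmax u"
  obtains ut where "classical_CH T u (\<lambda>t. deriv (u t)) ut"
proof -
  let ?I = "{t. 0 \<le> t \<and> ereal t < Tmax}"
  obtain ut where u: "sobolev_continuous_on s ?I u"
    and ut: "sobolev_has_derivative_on (s - 1) ?I u ut"
    and eq: "\<And>t x. t \<in> ?I \<Longrightarrow> ut t x + u t x * deriv (u t) x =
      - deriv (convolve CH_kernel (\<lambda>y. (u t y)\<^sup>2 + (deriv (u t) y)\<^sup>2 / 2)) x"
    using sol unfolding CH_solution_def Let_def by blast
  \<comment> \<open>As \<open>T\<close> lies strictly below \<open>Tmax\<close>, a closed interval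
    fits into the half-open domain; its compactness yields the bounds uniform in time.\<close>
  have sub: "{0..T} \<subseteq> ?I"
    using T(2) by (auto intro: le_less_trans[of "ereal _" "ereal T"])
  have I: "t \<in> ?I" if "t \<in> {0..T}" for t
    using that sub by blast
  have us: "u t \<in> sobolev_space s" if "t \<in> {0..T}" for t
    using u I[OF that] by (simp add: sobolev_continuous_on_def)
  have lim: "uniform_limit UNIV f l (at t within {0..T})" if "uniform_limit UNIV f l (at t within ?I)"
    for f :: "real \<Rightarrow> real \<Rightarrow> real" and l t
    using that filter_leD[OF at_le[OF sub]] unfolding uniform_limit_iff by blast
  obtain C where C: "\<And>f x. f \<in> sobolev_space s \<Longrightarrow> \<bar>f x\<bar> \<le> C * sobolev_norm s f"
    using sobolev_sup_bound[of s] s by auto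
  obtain C' where C': "\<And>f x. f \<in> sobolev_space s \<Longrightarrow> \<bar>deriv f x\<bar> \<le> C' * sobolev_norm s f"
    using sobolev_deriv_sup_bound[OF s] by blast
  have "classical_CH T u (\<lambda>t. deriv (u t)) ut"
  proof
    fix t assume t: "t \<in> {0..T}"
    show "(u t has_real_derivative deriv (u t) x) (at x)" for x
      by (rule sobolev_deriv(1)[OF s us[OF t]])
    show "continuous_on UNIV (deriv (u t))"
      by (intro continuous_at_imp_continuous_on ballI sobolev_deriv(2)[OF s us[OF t]])
    show "continuous_on UNIV (ut t)"
      using ut I[OF t] by (simp add: sobolev_has_derivative_on_def sobolev_space_def)
    show "bounded (range (u t))"
      using C[OF us[OF t]] by (auto simp: bounded_iff)
    show "bounded (range (deriv (u t)))"
      using C'[OF us[OF t]] by (auto simp: bounded_iff)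
    show "uniform_limit UNIV u (u t) (at t within {0..T})"
      using s by (intro lim sobolev_continuous_uniform_limit(1)[OF u I[OF t]]) auto
    show "uniform_limit UNIV (\<lambda>t. deriv (u t)) (deriv (u t)) (at t within {0..T})"
      by (intro lim sobolev_continuous_uniform_limit(2)[OF u I[OF t] s])
    show "uniform_limit UNIV (\<lambda>\<tau> x. (u \<tau> x - u t x) / (\<tau> - t)) (ut t) (at t within {0..T})"
      using s by (intro lim sobolev_derivative_uniform_limit[OF ut I[OF t]]) auto
    show "ut t x + u t x * deriv (u t) x =
        - deriv (convolve CH_kernel (\<lambda>y. (u t y)\<^sup>2 + (deriv (u t) y)\<^sup>2 / 2)) x" for x
      by (rule eq[OF I[OF t]])
  qed (rule T(1))
  then show ?thesis
    by (rule that)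
qed

theorem corollary2p3:
  fixes s :: real and u0 :: "real \<Rightarrow> real" and u :: "real \<Rightarrow> real \<Rightarrow> real" and Tstar :: ereal
  assumes "s > 3 / 2"
    and "u0 \<in> sobolev_space s"
    and "Tstar = CH_existence_time s u0"
    and "0 < Tstar"
    and "CH_solution s u0 Tstar u"
    and "\<exists>x0. deriv u0 x0 < - \<bar>u0 x0\<bar>"
  shows "Tstar < \<infinity>"
proof (rule ccontr)
  assume "\<not> Tstar < \<infinity>"
  obtain x0 where x0: "deriv u0 x0 < - \<bar>u0 x0\<bar>"
    using assms(6) by blast
  \<comment> \<open>The bound of \<open>lifespan_bound\<close> for these data. That bound is strict,
    so a solution on all of \<open>{0..T}\<close> would give T < T.\<close>
  define T where "T = 1 / (u0 x0 - deriv u0 x0) + 1 / (- u0 x0 - deriv u0 x0)"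
  have T: "0 \<le> T"
    unfolding T_def using x0 by (intro add_nonneg_nonneg divide_nonneg_nonneg) auto
  have "ereal T < Tstar"
    using \<open>\<not> Tstar < \<infinity>\<close> by simp
  then obtain ut where "classical_CH T u (\<lambda>t. deriv (u t)) ut"
    using CH_solution_classical[OF assms(1) T _ assms(5)] by blast
  moreover have "u 0 = u0"
    using assms(5) by (simp add: CH_solution_def Let_def)
  ultimately show False
    using classical_CH.lifespan_bound[of T u "\<lambda>t. deriv (u t)" ut x0] x0 by (simp add: T_def)
qed

end
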